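(* Let $\mathcal M$ be a countable structure with a local stationary independence relation and let $g\in\mathcal G=\mathrm{Aut}(\mathcal M)$ move maximally. If $\mathcal G$ contains a dense conjugacy class, then every element of $\mathcal G$ is the product of eight conjugates of $g$.
   Context: Let $\mathcal M$ be a structure and $\mathcal G=\mathrm{Aut}(\mathcal M)$, equipped with the topology of pointwise convergence: basic open sets are $\{h\in\mathcal G : u\subset h\}$ for $u$ a finite partial isomorphism of $\mathcal M$. Types: for a finite tuple $\bar a$ of $\mathcal M$ and a finite set $B\subset\mathcal M$, a tuple $\bar a'$ realises $\mathrm{tp}(\bar a/B)$ if some automorphism of $\mathcal M$ maps $\bar a$ to $\bar a'$ and fixes $B$ pointwise; $\mathrm{tp}(\bar a/B)=\mathrm{tp}(\bar a'/B)$ means the same thing. A type over $B$ is some $\mathrm{tp}(\bar a/B)$ with $\bar a$ a finite tuple of $\mathcal M$. We write $AB$ for $A\cup B$, and tuples are identified with their sets of entries (and finite sets with enumerating tuples) where convenient. A stationary independence relation on $\mathcal M$ is a ternary relation $A\perp_B C$ ("$A$ and $C$ are independent over $B$") between finite subsets of $\mathcal M$ satisfying: (Invariance) whether $A\perp_B C$ holds depends only on the type of $ABC$ (with $A,B,C$ enumerated); (Monotonicity) $A\perp_B CD$ implies $A\perp_B C$ and $A\perp_{BC} D$; (Transitivity) $A\perp_B C$ and $A\perp_{BC}D$ imply $A\perp_B D$; (Symmetry) $A\perp_B C$ implies $C\perp_B A$; (Existence) if $p$ is a type over $B$ and $C$ is a finite set, then $p$ has a realisation which is independent from $C$ over $B$;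 (Stationarity) if $\bar a$ and $\bar a'$ have the same type over $B$ and both are independent from $C$ over $B$, then $\bar a$ and $\bar a'$ have the same type over $BC$. The relation is a local stationary independence relation if $A\perp_B C$ is only defined for non-empty $B$ (and the axioms hold for non-empty bases). A finite tuple $\bar x$ is independent from a tuple $\bar y$ over $A;B$ if $\bar x\perp_A B\bar y$ and $\bar xA\perp_B\bar y$. For $g\in\mathcal G$ and $p$ a type over a finite set $X$, $g$ moves a realisation $\bar x$ of $p$ maximally if $\bar x$ is independent from $g(\bar x)$ over $X;g(X)$. In the local case, $g$ moves maximally if for all non-empty finite sets $X$ and all types $p$ over $X$, $g$ moves some realisation of $p$ maximally. *)

theory Defs
  imports "HOL-Analysis.Analysis"
begin

text \<open>
  The universe of a first-order structure is the whole type \<open>'a\<close>. The interpretations of symbols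
  outside the signature, and on lists of the wrong length, are junk values that nothing refers to.
  Constants are function symbols of arity 0.
\<close>

record ('a, 'f, 'r) fo_structure =
  fun_syms :: "'f set"
  fun_arity :: "'f \<Rightarrow> nat"
  fun_interp :: "'f \<Rightarrow> 'a list \<Rightarrow> 'a"
  rel_syms :: "'r set"
  rel_arity :: "'r \<Rightarrow> nat"
  rel_interp :: "'r \<Rightarrow> 'a list \<Rightarrow> bool"

definition Aut :: "('a, 'f, 'r) fo_structure \<Rightarrow> ('a \<Rightarrow> 'a) set" where
  "Aut M = {h. bij h \<and>
     (\<forall>f\<in>fun_syms M. \<forall>xs. length xs = fun_arity M f \<longrightarrow>
        h (fun_interp M f xs) = fun_interp M f (map h xs)) \<and>
     (\<forall>r\<in>rel_syms M. \<forall>xs. length xs = rel_arity M r \<longrightarrow>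
        (rel_interp M r (map h xs) \<longleftrightarrow> rel_interp M r xs))}"

definition conj_class :: "('a, 'f, 'r) fo_structure \<Rightarrow> ('a \<Rightarrow> 'a) \<Rightarrow> ('a \<Rightarrow> 'a) set" where
  "conj_class M g = {k \<circ> g \<circ> inv k | k. k \<in> Aut M}"

text \<open>
  The topology of pointwise convergence, the universe being discrete. By the lemma below, the sets
  of all automorphisms extending a given finite restriction of an automorphism form a basis.
  (A finite partial isomorphism that is not such a restriction has no extension in \<open>Aut M\<close> at all,
  so it would only contribute the empty set.)
\<close>

definition aut_topology :: "('a, 'f, 'r) fo_structure \<Rightarrow> ('a \<Rightarrow> 'a) topology" where
  "aut_topology M =
     subtopology (product_topology (\<lambda>_. discrete_topology UNIV) UNIV) (Aut M)"

lemma topspace_aut_topology [simp]: "topspace (aut_topology M) = Aut M"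
  by (simp add: aut_topology_def)

lemma openin_aut_topology_iff:
  "openin (aut_topology M) U \<longleftrightarrow>
     U \<subseteq> Aut M \<and> (\<forall>g\<in>U. \<exists>B. finite B \<and> {h \<in> Aut M. \<forall>x\<in>B. h x = g x} \<subseteq> U)"
  (is "?L \<longleftrightarrow> ?R")
proof
  assume ?L
  then obtain V where V: "openin (product_topology (\<lambda>_. discrete_topology (UNIV :: 'a set)) UNIV) V"
      and U: "U = V \<inter> Aut M"
    by (auto simp: aut_topology_def openin_subtopology)
  have "\<exists>B. finite B \<and> {h \<in> Aut M. \<forall>x\<in>B. h x = g x} \<subseteq> U" if "g \<in> U" for g
  proof -
    from that U have "g \<in> V" by simp
    with V obtain W where W: "finite {i. W i \<noteq> UNIV}" "g \<in> Pi\<^sub>E UNIV W" "Pi\<^sub>E UNIV W \<subseteq> V"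
      by (force simp: openin_product_topology_alt)
    have "{h \<in> Aut M. \<forall>x\<in>{i. W i \<noteq> UNIV}. h x = g x} \<subseteq> U"
    proof
      fix h assume h: "h \<in> {h \<in> Aut M. \<forall>x\<in>{i. W i \<noteq> UNIV}. h x = g x}"
      have "h i \<in> W i" for i
        using h W(2) by (cases "W i = UNIV") (auto simp: PiE_iff)
      with h W(3) U show "h \<in> U" by (auto simp: PiE_iff)
    qed
    with W(1) show ?thesis by blast
  qed
  with U show ?R by blast
next
  assume R: ?R
  have "\<exists>T. openin (aut_topology M) T \<and> g \<in> T \<and> T \<subseteq> U" if g: "g \<in> U" for g
  proof -
    from R g obtain B where B: "finite B" "{h \<in> Aut M. \<forall>x\<in>B. h x = g x} \<subseteq> U" by blast
    define W where "W = (\<lambda>i. if i \<in> B then {g i} else UNIV)"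
    have "finite {i. W i \<noteq> UNIV}"
      by (rule finite_subset[OF _ B(1)]) (auto simp: W_def)
    then have "openin (product_topology (\<lambda>_. discrete_topology (UNIV :: 'a set)) UNIV) (Pi\<^sub>E UNIV W)"
      by (simp add: openin_PiE_gen)
    then have "openin (aut_topology M) (Pi\<^sub>E UNIV W \<inter> Aut M)"
      by (auto simp: aut_topology_def openin_subtopology)
    moreover have "g \<in> Pi\<^sub>E UNIV W \<inter> Aut M"
      using R g by (auto simp: W_def)
    moreover have "Pi\<^sub>E UNIV W \<inter> Aut M \<subseteq> U"
    proof
      fix h assume h: "h \<in> Pi\<^sub>E UNIV W \<inter> Aut M"
      have "h x = g x" if "x \<in> B" for x
      proof -
        from h have "h x \<in> W x" by (auto simp: PiE_iff)
        with that show ?thesis by (simp add: W_def)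
      qed
      with h B(2) show "h \<in> U" by blast
    qed
    ultimately show ?thesis by blast
  qed
  then show ?L by (subst openin_subopen) blast
qed

text \<open>
  \<open>tp M xs B\<close> is identified with the set of its realisations, the orbit of the tuple \<open>xs\<close> under
  the pointwise stabiliser of \<open>B\<close>.
\<close>

definition tp :: "('a, 'f, 'r) fo_structure \<Rightarrow> 'a list \<Rightarrow> 'a set \<Rightarrow> 'a list set" where
  "tp M xs B = {map h xs | h. h \<in> Aut M \<and> (\<forall>b\<in>B. h b = b)}"

definition types_over :: "('a, 'f, 'r) fo_structure \<Rightarrow> 'a set \<Rightarrow> 'a list set set" where
  "types_over M B = {tp M xs B | xs. True}"

text \<open>
  \<open>indep A B C\<close> means that \<open>A\<close> and \<open>C\<close> are independent over the base \<open>B\<close> (the middle argument).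
  Nothing is required of \<open>indep\<close> when the base is empty or an argument is infinite.
\<close>

locale local_stationary_independence =
  fixes M :: "('a, 'f, 'r) fo_structure"
    and indep :: "'a set \<Rightarrow> 'a set \<Rightarrow> 'a set \<Rightarrow> bool"
  assumes invariance:
    "\<And>as bs cs as' bs' cs'. bs \<noteq> [] \<Longrightarrow>
       length as = length as' \<Longrightarrow> length bs = length bs' \<Longrightarrow> length cs = length cs' \<Longrightarrow>
       tp M (as @ bs @ cs) {} = tp M (as' @ bs' @ cs') {} \<Longrightarrow>
       indep (set as) (set bs) (set cs) \<longleftrightarrow> indep (set as') (set bs') (set cs')"
    and monotonicity:
    "\<And>A B C D. finite A \<Longrightarrow> finite B \<Longrightarrow> finite C \<Longrightarrow> finite D \<Longrightarrow> B \<noteq> {} \<Longrightarrow>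
       indep A B (C \<union> D) \<Longrightarrow> indep A B C \<and> indep A (B \<union> C) D"
    and transitivity:
    "\<And>A B C D. finite A \<Longrightarrow> finite B \<Longrightarrow> finite C \<Longrightarrow> finite D \<Longrightarrow> B \<noteq> {} \<Longrightarrow>
       indep A B C \<Longrightarrow> indep A (B \<union> C) D \<Longrightarrow> indep A B D"
    and symmetry:
    "\<And>A B C. finite A \<Longrightarrow> finite B \<Longrightarrow> finite C \<Longrightarrow> B \<noteq> {} \<Longrightarrow>
       indep A B C \<Longrightarrow> indep C B A"
    and existence:
    "\<And>B C p. finite B \<Longrightarrow> finite C \<Longrightarrow> B \<noteq> {} \<Longrightarrow> p \<in> types_over M B \<Longrightarrow>
       \<exists>xs\<in>p. indep (set xs) B C"
    and stationarity:
    "\<And>B C xs xs'. finite B \<Longrightarrow> finite C \<Longrightarrow> B \<noteq> {} \<Longrightarrow>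
       tp M xs B = tp M xs' B \<Longrightarrow> indep (set xs) B C \<Longrightarrow> indep (set xs') B C \<Longrightarrow>
       tp M xs (B \<union> C) = tp M xs' (B \<union> C)"

text \<open>\<open>indep_over2 indep xs ys A B\<close>: \<open>xs\<close> is independent from \<open>ys\<close> over \<open>A;B\<close> (a pair of bases).\<close>

definition indep_over2 ::
    "('a set \<Rightarrow> 'a set \<Rightarrow> 'a set \<Rightarrow> bool) \<Rightarrow> 'a list \<Rightarrow> 'a list \<Rightarrow> 'a set \<Rightarrow> 'a set \<Rightarrow> bool" where
  "indep_over2 indep xs ys A B \<longleftrightarrow>
     indep (set xs) A (B \<union> set ys) \<and> indep (set xs \<union> A) B (set ys)"

definition moves_maximally ::
    "('a, 'f, 'r) fo_structure \<Rightarrow> ('a set \<Rightarrow> 'a set \<Rightarrow> 'a set \<Rightarrow> bool) \<Rightarrow> ('a \<Rightarrow> 'a) \<Rightarrow> bool" where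
  "moves_maximally M indep g \<longleftrightarrow>
     (\<forall>X p. finite X \<and> X \<noteq> {} \<and> p \<in> types_over M X \<longrightarrow>
        (\<exists>xs\<in>p. indep_over2 indep xs (map g xs) X (g ` X)))"

end

theory Submission
  imports Defs
begin

text \<open>
  Write \<open>\<Phi>\<close> for the map sending a quadruple of automorphisms to the product of the corresponding
  conjugates of \<open>g\<close>. Stationarity together with maximal moving shows that \<open>\<Phi>\<close> maps every
  neighbourhood onto a somewhere dense set: after conjugating the four factors \<open>g\<^sub>i\<close> over a given
  finite set \<open>Y\<close> one finds finite sets \<open>X\<^sub>0, \<dots>, X\<^sub>4\<close> with \<open>g\<^sub>i X\<^sub>i\<^sub>-\<^sub>1 = X\<^sub>i\<close> such that \<open>X\<^sub>0X\<^sub>1\<close>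
  and \<open>X\<^sub>3X\<^sub>4\<close> are independent over \<open>Y\<close>, and then every automorphism extending the product on \<open>X\<^sub>0\<close>
  agrees on any prescribed finite set with a product of further conjugates over \<open>Y\<close>.
  For an automorphism \<open>f\<close> the map \<open>h \<mapsto> f \<circ> (\<Phi> h)\<^sup>-\<^sup>1\<close> inherits this property. The dense conjugacy
  class lets an open set in which the image of \<open>\<Phi>\<close> is dense be conjugated until it meets one for
  the second map, and successive approximation produces \<open>h\<close> and \<open>k\<close> with
  \<open>\<Phi> h = f \<circ> (\<Phi> k)\<^sup>-\<^sup>1\<close>.
\<close>

subsection \<open>Pointwise stabilisers and conjugates\<close>

lemma id_Aut [simp]: "id \<in> Aut M" "(\<lambda>x. x) \<in> Aut M"
  by (auto simp: Aut_def bij_def id_def)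

lemma Aut_bij: "h \<in> Aut M \<Longrightarrow> bij h"
  by (simp add: Aut_def)

lemma Aut_comp [intro]:
  assumes "h \<in> Aut M" "k \<in> Aut M" shows "h \<circ> k \<in> Aut M"
  using assms by (auto simp: Aut_def bij_comp simp flip: map_map)

lemma Aut_apply_inv [simp]: "h \<in> Aut M \<Longrightarrow> h (inv h x) = x" "h \<in> Aut M \<Longrightarrow> inv h (h x) = x"
  by (auto dest!: Aut_bij simp: bij_def surj_f_inv_f)

lemma Aut_inv_inv [simp]: "h \<in> Aut M \<Longrightarrow> inv (inv h) = h"
  by (simp add: Aut_bij inv_inv_eq)

lemma Aut_eq_iff: "h \<in> Aut M \<Longrightarrow> h x = h y \<longleftrightarrow> x = y"
  by (metis Aut_apply_inv(2))

lemma Aut_inv_eqI: "h \<in> Aut M \<Longrightarrow> h y = x \<Longrightarrow> inv h x = y"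
  by auto

lemma Aut_inv [intro]:
  assumes "h \<in> Aut M" shows "inv h \<in> Aut M"
proof -
  note [simp] = Aut_apply_inv[OF assms]
  have c: "h \<circ> inv h = id"
    by auto
  have "inv h (fun_interp M f xs) = fun_interp M f (map (inv h) xs)"
    if "f \<in> fun_syms M" "length xs = fun_arity M f" for f xs
  proof (rule Aut_inv_eqI[OF assms])
    show "h (fun_interp M f (map (inv h) xs)) = fun_interp M f xs"
      using that assms by (simp add: Aut_def c)
  qed
  moreover have "rel_interp M r (map (inv h) xs) \<longleftrightarrow> rel_interp M r xs"
    if "r \<in> rel_syms M" "length xs = rel_arity M r" for r xs
  proof -
    have "rel_interp M r (map h (map (inv h) xs)) \<longleftrightarrow> rel_interp M r (map (inv h) xs)"
      using that assms unfolding Aut_def by (simp del: map_map)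
    then show ?thesis by (simp add: c)
  qed
  ultimately show ?thesis
    using assms by (simp add: Aut_def bij_imp_bij_inv)
qed

lemma inv_Aut_comp: "h \<in> Aut M \<Longrightarrow> k \<in> Aut M \<Longrightarrow> inv (h \<circ> k) = inv k \<circ> inv h"
  by (simp add: Aut_bij o_inv_distrib)

definition fixing :: "('a, 'f, 'r) fo_structure \<Rightarrow> 'a set \<Rightarrow> ('a \<Rightarrow> 'a) set" where
  "fixing M P = {h \<in> Aut M. \<forall>x\<in>P. h x = x}"

lemma fixing_Aut: "h \<in> fixing M P \<Longrightarrow> h \<in> Aut M"
  by (simp add: fixing_def)

lemma fixing_apply: "h \<in> fixing M P \<Longrightarrow> x \<in> P \<Longrightarrow> h x = x"
  by (simp add: fixing_def)

lemma fixingI: "h \<in> Aut M \<Longrightarrow> (\<And>x. x \<in> P \<Longrightarrow> h x = x) \<Longrightarrow> h \<in> fixing M P"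
  by (simp add: fixing_def)

lemma fixing_image: "h \<in> fixing M P \<Longrightarrow> Q \<subseteq> P \<Longrightarrow> h ` Q = Q"
  by (force simp: fixing_def)

lemma fixing_mono: "h \<in> fixing M P \<Longrightarrow> Q \<subseteq> P \<Longrightarrow> h \<in> fixing M Q"
  by (auto simp: fixing_def)

lemma fixing_comp: "h \<in> fixing M P \<Longrightarrow> k \<in> fixing M P \<Longrightarrow> h \<circ> k \<in> fixing M P"
  by (auto simp: fixing_def)

lemma fixing_inv: "h \<in> fixing M P \<Longrightarrow> inv h \<in> fixing M P"
  by (auto simp: fixing_def intro: Aut_inv_eqI)

section \<open>Conjugates by elements of a pointwise stabiliser\<close>

definition conjs :: "('a, 'f, 'r) fo_structure \<Rightarrow> 'a set \<Rightarrow> ('a \<Rightarrow> 'a) \<Rightarrow> ('a \<Rightarrow> 'a) set" where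
  "conjs M P g = {a \<circ> g \<circ> inv a | a. a \<in> fixing M P}"

lemma conjsI: "a \<in> fixing M P \<Longrightarrow> a \<circ> g \<circ> inv a \<in> conjs M P g"
  by (auto simp: conjs_def)

lemma conjs_mono: "k \<in> conjs M P g \<Longrightarrow> Q \<subseteq> P \<Longrightarrow> k \<in> conjs M Q g"
  by (auto simp: conjs_def intro: fixing_mono)

lemma conjs_trans:
  assumes "k \<in> conjs M P g" "l \<in> conjs M P k" shows "l \<in> conjs M P g"
proof -
  obtain a b where a: "a \<in> fixing M P" "k = a \<circ> g \<circ> inv a" and b: "b \<in> fixing M P" "l = b \<circ> k \<circ> inv b"
    using assms by (auto simp: conjs_def)
  have "l = (b \<circ> a) \<circ> g \<circ> inv (b \<circ> a)"
    using a b inv_Aut_comp[OF fixing_Aut fixing_Aut, OF b(1) a(1)] by (simp add: o_assoc)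
  then show ?thesis
    using conjsI[OF fixing_comp[OF b(1) a(1)]] by metis
qed

lemma conjs_Aut: "k \<in> conjs M P g \<Longrightarrow> g \<in> Aut M \<Longrightarrow> k \<in> Aut M"
  by (auto simp: conjs_def dest: fixing_Aut)

lemma conjs_inv:
  assumes "k \<in> conjs M P g" "g \<in> Aut M" shows "inv k \<in> conjs M P (inv g)"
proof -
  obtain a where a: "a \<in> fixing M P" "k = a \<circ> g \<circ> inv a"
    using assms by (auto simp: conjs_def)
  have "a \<in> Aut M"
    using a(1) by (rule fixing_Aut)
  then have "inv k = a \<circ> inv g \<circ> inv a"
    using a(2) assms(2) by (intro inv_unique_comp) (auto simp: fun_eq_iff)
  then show ?thesis
    using conjsI[OF a(1)] by metis
qed

text \<open>The conjugator and its inverse fix \<open>x\<close> and \<open>g x\<close>, so the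
  values of \<open>g\<close> inside \<open>P\<close> survive every conjugation over
  \<open>P\<close>.\<close>

lemma conjs_eq:
  assumes "k \<in> conjs M P g" "x \<in> P" "g x \<in> P" shows "k x = g x"
  using assms by (auto simp: conjs_def fixing_apply[OF fixing_inv] fixing_apply)

lemma conjs_image_eq:
  assumes "k \<in> conjs M P g" "Q \<subseteq> P" "g ` Q \<subseteq> P" shows "k ` Q = g ` Q"
  using assms by (intro image_cong) (auto intro: conjs_eq)

subsection \<open>Independence and maximal moving\<close>

context local_stationary_independence
begin

text \<open>Bundles the side conditions of the axioms with the relation, so that later lemmas need
  not repeat them.\<close>

definition ind :: "'a set \<Rightarrow> 'a set \<Rightarrow> 'a set \<Rightarrow> bool" where
  "ind A B C \<longleftrightarrow> finite A \<and> finite B \<and> finite C \<and> B \<noteq> {} \<and> indep A B C"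

lemma ind_image:
  assumes "ind A B C" "h \<in> Aut M" shows "ind (h ` A) (h ` B) (h ` C)"
proof -
  obtain as bs cs where l: "A = set as" "B = set bs" "C = set cs"
    using assms(1) unfolding ind_def by (metis finite_list)
  have "bs \<noteq> []"
    using assms(1) l by (auto simp: ind_def)
  have "tp M (map h xs) {} = tp M xs {}" for xs
  proof
    show "tp M (map h xs) {} \<subseteq> tp M xs {}"
      using assms(2) unfolding tp_def map_map by blast
    have "map k xs = map (k \<circ> inv h) (map h xs)" for k
      using assms(2) by simp
    then show "tp M xs {} \<subseteq> tp M (map h xs) {}"
      using assms(2) unfolding tp_def by blast
  qed
  from this[of "as @ bs @ cs", symmetric]
  have "indep (set as) (set bs) (set cs) \<longleftrightarrow> indep (set (map h as)) (set (map h bs)) (set (map h cs))"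
    using \<open>bs \<noteq> []\<close> by (intro invariance) auto
  then show ?thesis
    using assms(1) l by (auto simp: ind_def)
qed

lemma ind_sym: "ind A B C \<Longrightarrow> ind C B A"
  by (auto simp: ind_def intro: symmetry)

lemma ind_mono_right:
  assumes "ind A B C" "D \<subseteq> C" shows "ind A B D"
proof -
  have "C = D \<union> C" using assms(2) by auto
  then show ?thesis
    using monotonicity[of A B D C] assms by (auto simp: ind_def finite_subset)
qed

lemma ind_mono: "ind A B C \<Longrightarrow> A' \<subseteq> A \<Longrightarrow> C' \<subseteq> C \<Longrightarrow> ind A' B C'"
  by (meson ind_mono_right ind_sym)

text \<open>A realisation of a type over \<open>B\<close> is the image of an enumeration under an
  automorphism fixing \<open>B\<close>, so existence can be read as a statement about
  automorphisms.\<close>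

lemma ind_exists:
  assumes "finite A" "finite B" "finite C" "B \<noteq> {}"
  obtains h where "h \<in> fixing M B" "ind (h ` A) B C"
proof -
  obtain xs where xs: "A = set xs"
    using assms(1) by (metis finite_list)
  have "tp M xs B \<in> types_over M B"
    by (auto simp: types_over_def)
  from existence[OF assms(2,3,4) this] obtain ys where ys: "ys \<in> tp M xs B" "indep (set ys) B C"
    by blast
  then obtain h where "h \<in> fixing M B" "ys = map h xs"
    by (auto simp: tp_def fixing_def)
  with ys assms xs that show thesis
    by (auto simp: ind_def)
qed

text \<open>Equality of types over \<open>B \<union> C\<close> is witnessed by an automorphism,
  which can replace \<open>h\<close> on \<open>A\<close> and fixes \<open>C\<close> as well.\<close>

lemma ind_stationary:
  assumes "h \<in> fixing M B" "ind A B C" "ind (h ` A) B C"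
  obtains k where "k \<in> fixing M (B \<union> C)" "\<And>x. x \<in> A \<Longrightarrow> k x = h x"
proof -
  obtain xs where xs: "A = set xs"
    using assms(2) unfolding ind_def by (metis finite_list)
  have h: "h \<in> Aut M"
    using assms(1) by (rule fixing_Aut)
  have "tp M (map h xs) B = tp M xs B"
  proof
    show "tp M (map h xs) B \<subseteq> tp M xs B"
    proof
      fix ys assume "ys \<in> tp M (map h xs) B"
      then obtain k where "k \<in> fixing M B" "ys = map (k \<circ> h) xs"
        by (auto simp: tp_def fixing_def)
      then show "ys \<in> tp M xs B"
        using fixing_comp[OF _ assms(1), of k] unfolding tp_def fixing_def by blast
    qed
    show "tp M xs B \<subseteq> tp M (map h xs) B"
    proof
      fix ys assume "ys \<in> tp M xs B"
      then obtain k where k: "k \<in> Aut M" "\<forall>b\<in>B. k b = b" "ys = map k xs"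
        by (auto simp: tp_def)
      have "k \<circ> inv h \<in> Aut M \<and> (\<forall>b\<in>B. (k \<circ> inv h) b = b)"
        using k h assms(1) by (auto simp: fixing_apply[OF fixing_inv])
      moreover have "ys = map (k \<circ> inv h) (map h xs)"
        using k h by simp
      ultimately show "ys \<in> tp M (map h xs) B"
        unfolding tp_def by blast
    qed
  qed
  then have "tp M xs (B \<union> C) = tp M (map h xs) (B \<union> C)"
    using assms(2,3) xs by (intro stationarity) (auto simp: ind_def)
  moreover have "map h xs \<in> tp M (map h xs) (B \<union> C)"
    unfolding tp_def by (intro CollectI exI[of _ id]) auto
  ultimately have "map h xs \<in> tp M xs (B \<union> C)"
    by simp
  then obtain k where "k \<in> fixing M (B \<union> C)" "map h xs = map k xs"
    by (auto simp: tp_def fixing_def)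
  with that xs show thesis
    by (metis list.set_map map_eq_conv)
qed

text \<open>Base points may be added on the right: existence gives a copy of \<open>A\<close>
  independent from \<open>B \<union> C\<close>, and stationarity moves that copy back to
  \<open>A\<close> over \<open>B \<union> C\<close>.\<close>

lemma ind_absorb:
  assumes "ind A B C" "D \<subseteq> B \<union> C" shows "ind A B D"
proof -
  have fin: "finite A" "finite B" "finite (B \<union> C)" "B \<noteq> {}"
    using assms(1) by (auto simp: ind_def)
  obtain h where h: "h \<in> fixing M B" "ind (h ` A) B (B \<union> C)"
    using ind_exists[OF fin] by blast
  then obtain k where k: "k \<in> fixing M (B \<union> C)" "\<And>x. x \<in> A \<Longrightarrow> k x = h x"
    using ind_stationary[OF h(1) assms(1)] ind_mono_right by (metis Un_upper2)
  have "ind (inv k ` h ` A) (inv k ` B) (inv k ` (B \<union> C))"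
    using ind_image[OF h(2)] k(1) by (auto dest: fixing_Aut)
  moreover have "inv k ` h ` A = A"
    using k by (force simp: image_image dest: fixing_Aut simp flip: k(2))
  ultimately have "ind A B (B \<union> C)"
    using k(1) by (simp add: fixing_image[OF fixing_inv])
  then show ?thesis
    using assms(2) by (rule ind_mono_right)
qed

lemma ind_base:
  assumes "ind A B C" "B \<subseteq> B'" "B' \<subseteq> B \<union> C" "D \<subseteq> B \<union> C" shows "ind A B' D"
proof -
  have "ind A B (B' \<union> D)"
    using assms by (auto intro: ind_absorb)
  then have "ind A (B \<union> B') D"
    using monotonicity[of A B B' D] by (auto simp: ind_def)
  moreover have "B \<union> B' = B'"
    using assms(2) by auto
  ultimately show ?thesis
    by simp
qed

lemma ind_trans:
  assumes "ind A B E" "ind A B' C" "B \<subseteq> B'" "B' \<subseteq> B \<union> E" "D \<subseteq> B' \<union> C"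
  shows "ind A B D"
proof -
  have "ind A B B'" "ind A B' D"
    using assms by (auto intro: ind_absorb)
  moreover have "B \<union> B' = B'"
    using assms(3) by auto
  ultimately show ?thesis
    using transitivity[of A B B' D] by (auto simp: ind_def)
qed

text \<open>Transitivity on the left, obtained by exchanging the sides. The set \<open>S\<close>
  lets the new piece \<open>E\<close> be independent over any base between \<open>B\<close> and
  \<open>B \<union> A\<close>.\<close>

lemma ind_extend:
  assumes "ind A B C" "ind E S D" "B \<subseteq> S" "S \<subseteq> B \<union> A" "A \<union> C \<subseteq> S \<union> D"
  shows "ind (A \<union> E) B C"
proof -
  have "ind E (B \<union> A) C"
    using assms by (intro ind_base[OF assms(2)]) auto
  then have "ind C (B \<union> A) E"
    by (rule ind_sym)
  then have "ind C B (A \<union> E)"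
    by (rule ind_trans[OF ind_sym[OF assms(1)]]) auto
  then show ?thesis
    by (rule ind_sym)
qed

text \<open>The realisations of the type of \<open>A\<close> over \<open>X\<close> appear as the images \<open>h ` A\<close>, so that only sets
  have to be handled.\<close>

definition mover :: "('a \<Rightarrow> 'a) \<Rightarrow> bool" where
  "mover g \<longleftrightarrow> g \<in> Aut M \<and> (\<forall>X A. finite X \<longrightarrow> X \<noteq> {} \<longrightarrow> finite A \<longrightarrow>
     (\<exists>h\<in>fixing M X. ind (h ` A) X (g ` X \<union> g ` h ` A) \<and> ind (h ` A \<union> X) (g ` X) (g ` h ` A)))"

lemma mover_Aut: "mover g \<Longrightarrow> g \<in> Aut M"
  by (simp add: mover_def)

lemma moverE:
  assumes "mover g" "finite X" "X \<noteq> {}" "finite A"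
  obtains h where "h \<in> fixing M X" "ind (h ` A) X (g ` X \<union> g ` h ` A)"
    "ind (h ` A \<union> X) (g ` X) (g ` h ` A)"
  using assms unfolding mover_def by blast

section \<open>Closure properties and consequences of maximal moving\<close>

lemma moves_maximally_mover:
  assumes "g \<in> Aut M" "moves_maximally M indep g" shows "mover g"
  unfolding mover_def
proof (intro conjI allI impI assms(1))
  fix X A :: "'a set" assume fin: "finite X" "X \<noteq> {}" "finite A"
  then obtain xs where xs: "A = set xs"
    by (metis finite_list)
  have "tp M xs X \<in> types_over M X"
    by (auto simp: types_over_def)
  then obtain ys where ys: "ys \<in> tp M xs X" "indep_over2 indep ys (map g ys) X (g ` X)"
    using assms(2) fin unfolding moves_maximally_def by blast
  then obtain h where "h \<in> fixing M X" "ys = map h xs"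
    by (auto simp: tp_def fixing_def)
  with ys fin xs
  show "\<exists>h\<in>fixing M X. ind (h ` A) X (g ` X \<union> g ` h ` A) \<and> ind (h ` A \<union> X) (g ` X) (g ` h ` A)"
    by (intro bexI[of _ h]) (simp_all add: ind_def indep_over2_def image_image)
qed

lemma mover_conj:
  assumes "mover g" "k \<in> Aut M" shows "mover (k \<circ> g \<circ> inv k)"
  unfolding mover_def
proof (intro conjI allI impI)
  show "k \<circ> g \<circ> inv k \<in> Aut M"
    using assms mover_Aut by blast
  fix X A :: "'a set" assume fin: "finite X" "X \<noteq> {}" "finite A"
  then obtain h where h: "h \<in> fixing M (inv k ` X)"
    "ind (h ` inv k ` A) (inv k ` X) (g ` inv k ` X \<union> g ` h ` inv k ` A)"
    "ind (h ` inv k ` A \<union> inv k ` X) (g ` inv k ` X) (g ` h ` inv k ` A)"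
    using moverE[OF assms(1), of "inv k ` X" "inv k ` A"] by blast
  let ?h = "k \<circ> h \<circ> inv k"
  have "?h \<in> fixing M X"
    using h(1) assms(2) by (auto simp: fixing_def)
  moreover note ind_image[OF h(2) assms(2)] ind_image[OF h(3) assms(2)]
  ultimately show "\<exists>h\<in>fixing M X. ind (h ` A) X ((k \<circ> g \<circ> inv k) ` X \<union> (k \<circ> g \<circ> inv k) ` h ` A) \<and>
      ind (h ` A \<union> X) ((k \<circ> g \<circ> inv k) ` X) ((k \<circ> g \<circ> inv k) ` h ` A)"
    using assms(2) by (intro bexI[of _ ?h]) (simp_all add: image_image image_Un)
qed

lemma mover_conjs: "mover g \<Longrightarrow> k \<in> conjs M P g \<Longrightarrow> mover k"
  by (auto simp: conjs_def dest: fixing_Aut intro: mover_conj)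

text \<open>Apply the property of \<open>g\<close> to the preimages of \<open>X\<close> and
  \<open>A\<close>; symmetry then exchanges the two halves of the condition.\<close>

lemma mover_inv:
  assumes "mover g" shows "mover (inv g)"
  unfolding mover_def
proof (intro conjI allI impI)
  have g: "g \<in> Aut M"
    using assms by (rule mover_Aut)
  then show "inv g \<in> Aut M"
    by blast
  fix X A :: "'a set" assume fin: "finite X" "X \<noteq> {}" "finite A"
  then obtain h where h: "h \<in> fixing M (inv g ` X)"
    "ind (h ` inv g ` A) (inv g ` X) (g ` inv g ` X \<union> g ` h ` inv g ` A)"
    "ind (h ` inv g ` A \<union> inv g ` X) (g ` inv g ` X) (g ` h ` inv g ` A)"
    using moverE[OF assms(1), of "inv g ` X" "inv g ` A"] by blast
  let ?h = "g \<circ> h \<circ> inv g"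
  have "?h \<in> fixing M X"
    using h(1) g by (auto simp: fixing_def)
  moreover note ind_sym[OF h(2)] ind_sym[OF h(3)]
  ultimately show "\<exists>h\<in>fixing M X. ind (h ` A) X (inv g ` X \<union> inv g ` h ` A) \<and>
      ind (h ` A \<union> X) (inv g ` X) (inv g ` h ` A)"
    using g by (intro bexI[of _ ?h]) (simp_all add: image_image Un_commute)
qed

text \<open>Conjugating by the inverse of the automorphism that produces the maximally moved copy
  puts \<open>A\<close> in the place of this copy. A second conjugation frees the images from
  \<open>C\<close>.\<close>

lemma mover_spread:
  assumes "mover g" "finite P" "P \<noteq> {}" "finite A" "finite C"
  obtains k where "k \<in> conjs M P g" "ind (k ` A \<union> k ` P) P (A \<union> C)" "ind (k ` A) (k ` P) (A \<union> P)"
proof -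
  obtain h where h: "h \<in> fixing M P" "ind (h ` A) P (g ` P \<union> g ` h ` A)"
    "ind (h ` A \<union> P) (g ` P) (g ` h ` A)"
    using moverE[OF assms(1-4)] .
  have aut: "g \<in> Aut M" "h \<in> Aut M" "inv h \<in> Aut M"
    using assms(1) h(1) by (auto simp: mover_def fixing_def)
  define k where "k = inv h \<circ> g \<circ> inv (inv h)"
  have k: "k \<in> conjs M P g"
    unfolding k_def by (intro conjsI fixing_inv h)
  have kAut: "k \<in> Aut M"
    using k aut(1) by (rule conjs_Aut)
  have kP: "k ` P = inv h ` g ` P" "k ` A = inv h ` g ` h ` A"
    using aut fixing_apply[OF h(1)] by (auto simp: k_def image_image)
  have hh: "inv h ` h ` A = A" "inv h ` P = P"
    using aut fixing_image[OF fixing_inv[OF h(1)]] by (simp_all add: image_image)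
  have 1: "ind A P (k ` P \<union> k ` A)" "ind (A \<union> P) (k ` P) (k ` A)"
    using ind_image[OF h(2) aut(3)] ind_image[OF h(3) aut(3)]
    unfolding image_Un hh kP[symmetric] by auto
  \<comment> \<open>\<open>r\<close> fixes \<open>A \<union> P\<close>, so the independence from
    \<open>A\<close> is kept while the images become free from \<open>C\<close>.\<close>
  obtain r where r: "r \<in> fixing M (A \<union> P)" "ind (r ` (k ` A \<union> k ` P)) (A \<union> P) C"
    using ind_exists[of "k ` A \<union> k ` P" "A \<union> P" C] assms by blast
  have rAut: "r \<in> Aut M"
    using r(1) by (rule fixing_Aut)
  define l where "l = r \<circ> k \<circ> inv r"
  have "l \<in> conjs M P k"
    unfolding l_def using r(1) by (intro conjsI fixing_mono[OF r(1)]) auto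
  with k have l: "l \<in> conjs M P g"
    by (rule conjs_trans)
  have lP: "l ` P = r ` k ` P" "l ` A = r ` k ` A"
    using fixing_image[OF fixing_inv[OF r(1)]] unfolding l_def image_comp[symmetric] by simp_all
  have rA: "r ` A = A" "r ` P = P"
    using fixing_image[OF r(1)] by simp_all
  have 2: "ind (l ` A \<union> l ` P) P A" "ind (A \<union> P) (l ` P) (l ` A)"
    using ind_image[OF 1(1) rAut] ind_image[OF 1(2) rAut]
    unfolding image_Un rA lP[symmetric] by (auto simp: Un_commute intro: ind_sym)
  have "ind (l ` A \<union> l ` P) P (A \<union> C)"
    using 2(1) r(2) unfolding image_Un lP[symmetric] by (rule ind_trans) auto
  with l ind_sym[OF 2(2)] that show thesis
    by blast
qed

text \<open>By stationarity there is only one type of a pair that is independent over \<open>X; g X\<close> and whose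
  components realise prescribed types, so such a pair is moved by a conjugate of \<open>g\<close>.\<close>

lemma mover_transport:
  assumes "mover g" "s \<in> fixing M (g ` X)"
    and ind: "ind A X (g ` X)" "ind (s ` g ` A) (g ` X) (A \<union> X)"
  obtains k where "k \<in> conjs M (X \<union> g ` X) g" "\<And>x. x \<in> A \<Longrightarrow> k x = s (g x)"
proof -
  have fin: "finite X" "X \<noteq> {}" "finite A"
    using ind by (auto simp: ind_def)
  obtain h where h: "h \<in> fixing M X" "ind (h ` A) X (g ` X \<union> g ` h ` A)"
    "ind (h ` A \<union> X) (g ` X) (g ` h ` A)"
    using moverE[OF assms(1) fin] .
  \<comment> \<open>\<open>r\<close> takes \<open>A\<close> to its maximally moved copy and fixes
    \<open>X\<close> and \<open>g X\<close>; conjugating \<open>g\<close> by \<open>inv r\<close>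
    makes \<open>A\<close> itself the moved set.\<close>
  obtain r where r: "r \<in> fixing M (X \<union> g ` X)" "\<And>x. x \<in> A \<Longrightarrow> r x = h x"
    using ind_stationary[OF h(1) ind(1) ind_mono_right[OF h(2)]] by blast
  have aut: "g \<in> Aut M" "r \<in> Aut M" "s \<in> Aut M"
    using assms(1,2) r(1) by (auto simp: mover_def fixing_def)
  define k where "k = inv r \<circ> g \<circ> inv (inv r)"
  have k: "k \<in> conjs M (X \<union> g ` X) g"
    unfolding k_def by (intro conjsI fixing_inv r)
  have kAut: "k \<in> Aut M"
    using k aut(1) by (rule conjs_Aut)
  have kX: "k x = g x" if "x \<in> X" for x
    using conjs_eq[OF k] that by blast
  have "inv r ` h ` A = A"
    using r(2) aut by (force simp: image_image simp flip: r(2))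
  moreover have "inv r ` g ` h ` A = k ` A"
    using r(2) aut by (simp add: k_def image_image)
  moreover have "inv r ` X = X" "inv r ` g ` X = g ` X"
    using fixing_image[OF fixing_inv[OF r(1)]] by simp_all
  ultimately have 1: "ind (A \<union> X) (g ` X) (k ` A)"
    using ind_image[OF h(3), of "inv r"] aut by (auto simp: image_Un)
  \<comment> \<open>\<open>t\<close> takes the image under \<open>k\<close> to the required one. It
    fixes \<open>g X\<close> because \<open>k\<close> agrees with \<open>g\<close> on
    \<open>X\<close>.\<close>
  define t where "t = s \<circ> g \<circ> inv k"
  have "t y = y" if "y \<in> g ` X" for y
  proof -
    from that obtain x where x: "x \<in> X" "y = g x"
      by blast
    then have "inv k y = x"
      using kX kAut by (metis Aut_apply_inv(2))
    then show ?thesis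
      using x fixing_apply[OF assms(2) that] by (simp add: t_def)
  qed
  then have t: "t \<in> fixing M (g ` X)"
    unfolding t_def using aut kAut by (intro fixingI) (auto simp: t_def)
  have tk: "t (k x) = s (g x)" for x
    using kAut by (simp add: t_def)
  then have "ind (t ` k ` A) (g ` X) (A \<union> X)"
    using ind(2) by (simp add: image_image)
  \<comment> \<open>The replacement \<open>q\<close> also fixes \<open>A\<close> and
    \<open>X\<close>, so conjugating by it corrects the images of \<open>A\<close> and leaves
    \<open>A\<close> in place.\<close>
  from ind_stationary[OF t ind_sym[OF 1] this] obtain q where
    q: "q \<in> fixing M (g ` X \<union> (A \<union> X))" "\<And>x. x \<in> k ` A \<Longrightarrow> q x = t x"
    by blast
  define l where "l = q \<circ> k \<circ> inv q"
  have "l \<in> conjs M (X \<union> g ` X) k"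
    unfolding l_def by (intro conjsI fixing_mono[OF q(1)]) auto
  with k have "l \<in> conjs M (X \<union> g ` X) g"
    by (rule conjs_trans)
  moreover have "l x = s (g x)" if "x \<in> A" for x
    using that q(2) fixing_apply[OF fixing_inv[OF q(1)], of x] tk by (simp add: l_def)
  ultimately show thesis
    using that by blast
qed

text \<open>The chain is \<open>Y \<union> u0 \<rightarrow> b1 \<union> r \<rightarrow> u \<union> v \<union> Y \<rightarrow> b3 \<union> s \<rightarrow> Y \<union> v4\<close>, where the images of \<open>Y\<close>
  are taken forwards from \<open>X0\<close> (\<open>b1\<close>, \<open>u\<close>, then \<open>s\<close>, \<open>v4\<close>) and backwards from \<open>X4\<close> (\<open>b3\<close>, \<open>v\<close>, then \<open>r\<close>, \<open>u0\<close>).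
  Each new piece is made independent from everything on the other side over the pieces that the
  conjugation has to fix.\<close>

lemma spread_chain:
  assumes g: "mover g1" "mover g2" "mover g3" "mover g4" and Y: "finite Y" "Y \<noteq> {}"
  obtains k1 k2 k3 k4 X0 X1 X2 X3 X4 where
    "k1 \<in> conjs M Y g1" "k2 \<in> conjs M Y g2" "k3 \<in> conjs M Y g3" "k4 \<in> conjs M Y g4"
    "X1 = k1 ` X0" "X2 = k2 ` X1" "X3 = k3 ` X2" "X4 = k4 ` X3"
    "Y \<subseteq> X0" "Y \<subseteq> X2" "Y \<subseteq> X4" "finite X0" "ind (X0 \<union> X1) Y (X3 \<union> X4)"
proof -
  note [simp] = image_Un image_image
  note aut = g[THEN mover_Aut]
  \<comment> \<open>Taken from \<open>g4\<close> itself: the later conjugation of \<open>g4\<close>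
    is over \<open>Y \<union> b3\<close>, so \<open>l4\<close> still maps \<open>b3\<close> onto
    \<open>Y\<close>.\<close>
  define b3 where "b3 = inv g4 ` Y"
  obtain k1 where k1: "k1 \<in> conjs M Y g1" "ind (k1 ` Y) Y b3"
    using mover_spread[OF g(1) Y, of Y b3] Y ind_mono
    by (metis b3_def finite_imageI sup_ge2 Un_upper1)
  define b1 where "b1 = k1 ` Y"
  have fin: "finite b1" "finite b3"
    using Y by (simp_all add: b1_def b3_def)
  have I1: "ind b1 Y b3"
    using k1 by (simp add: b1_def)
  obtain k2 where k2: "k2 \<in> conjs M Y g2" "ind (k2 ` b1 \<union> k2 ` Y) Y (b1 \<union> b3)"
    using mover_spread[OF g(2) Y, of b1 b3] fin by blast
  define u where "u = k2 ` b1"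
  have finu: "finite u"
    using fin by (simp add: u_def)
  have "ind u Y (b1 \<union> b3)"
    using k2(2) unfolding u_def by (rule ind_mono) auto
  with I1 have I2: "ind (b1 \<union> u) Y b3"
    by (rule ind_extend) auto
  obtain k3' where k3': "k3' \<in> conjs M Y (inv g3)" "ind (k3' ` b3 \<union> k3' ` Y) Y (b3 \<union> (b1 \<union> u))"
    using mover_spread[OF mover_inv[OF g(3)] Y, of b3 "b1 \<union> u"] fin finu by blast
  define v where "v = k3' ` b3"
  have finv: "finite v"
    using fin by (simp add: v_def)
  have "ind v Y (b3 \<union> (b1 \<union> u))"
    using k3'(2) unfolding v_def by (rule ind_mono) auto
  with ind_sym[OF I2] have I3: "ind (b3 \<union> v) Y (b1 \<union> u)"
    by (rule ind_extend) auto
  \<comment> \<open>Fixing \<open>S\<close> keeps \<open>b1\<close> mapped to \<open>u\<close> by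
    the second map, while the preimage \<open>r\<close> of \<open>v \<union> Y\<close> is made free
    over \<open>S\<close>.\<close>
  define S where "S = Y \<union> b1 \<union> u"
  have S: "finite S" "S \<noteq> {}"
    using Y fin finu by (auto simp: S_def)
  have mk2: "mover (inv k2)"
    by (rule mover_inv[OF mover_conjs[OF g(2) k2(1)]])
  have finvY: "finite (v \<union> Y)" "finite (u \<union> Y)"
    using finu finv Y by auto
  obtain l2' where l2': "l2' \<in> conjs M S (inv k2)"
      "ind (l2' ` (v \<union> Y) \<union> l2' ` S) S ((v \<union> Y) \<union> b3)"
    using mover_spread[OF mk2 S, of "v \<union> Y" b3] fin finvY by blast
  define r where "r = l2' ` (v \<union> Y)"
  have finr: "finite r"
    using finvY by (simp add: r_def)
  have "ind r S (v \<union> Y \<union> b3)"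
    using l2'(2) unfolding r_def by (rule ind_mono) auto
  then have I4: "ind (b1 \<union> u \<union> r) Y (b3 \<union> v)"
    by (intro ind_extend[OF ind_sym[OF I3], of r S "S \<union> (v \<union> Y \<union> b3)"])
      (auto simp: S_def intro: ind_absorb)
  define T where "T = Y \<union> b3 \<union> v"
  have T: "finite T" "T \<noteq> {}"
    using Y fin finv by (auto simp: T_def)
  have aut3: "k3' \<in> Aut M"
    using k3'(1) aut by (blast intro: conjs_Aut Aut_inv)
  have "mover k3'"
    using mover_inv[OF g(3)] k3'(1) by (rule mover_conjs)
  then have mk3: "mover (inv k3')"
    by (rule mover_inv)
  obtain l3 where l3: "l3 \<in> conjs M T (inv k3')"
      "ind (l3 ` (u \<union> Y) \<union> l3 ` T) T ((u \<union> Y) \<union> (b1 \<union> r))"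
    using mover_spread[OF mk3 T, of "u \<union> Y" "b1 \<union> r"] fin finvY finr by blast
  define s where "s = l3 ` (u \<union> Y)"
  have fins: "finite s"
    using finvY by (simp add: s_def)
  have "ind s T (u \<union> Y \<union> (b1 \<union> r))"
    using l3(2) unfolding s_def by (rule ind_mono) auto
  then have I5: "ind (b3 \<union> v \<union> s) Y (b1 \<union> u \<union> r)"
    by (intro ind_extend[OF ind_sym[OF I4], of s T "T \<union> (u \<union> Y \<union> (b1 \<union> r))"])
      (auto simp: T_def intro: ind_absorb)
  have I5': "ind (b1 \<union> r) Y (b3 \<union> s)"
    using ind_sym[OF I5] by (rule ind_mono) auto
  have mk1: "mover (inv k1)"
    by (rule mover_inv[OF mover_conjs[OF g(1) k1(1)]])
  have P: "finite (Y \<union> b1)" "Y \<union> b1 \<noteq> {}" "finite (Y \<union> b3)" "Y \<union> b3 \<noteq> {}"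
    using Y fin by auto
  obtain l1' where l1': "l1' \<in> conjs M (Y \<union> b1) (inv k1)"
      "ind (l1' ` r \<union> l1' ` (Y \<union> b1)) (Y \<union> b1) (r \<union> (b3 \<union> s))"
    using mover_spread[OF mk1 P(1,2), of r "b3 \<union> s"] fin finr fins by blast
  define u0 where "u0 = l1' ` r"
  have finu0: "finite u0"
    using finr by (simp add: u0_def)
  have "ind u0 (Y \<union> b1) (r \<union> (b3 \<union> s))"
    using l1'(2) unfolding u0_def by (rule ind_mono) auto
  then have I6: "ind (b1 \<union> r \<union> u0) Y (b3 \<union> s)"
    by (intro ind_extend[OF I5', of u0 "Y \<union> b1" "r \<union> (b3 \<union> s)"]) auto
  obtain l4 where l4: "l4 \<in> conjs M (Y \<union> b3) g4"
      "ind (l4 ` s \<union> l4 ` (Y \<union> b3)) (Y \<union> b3) (s \<union> (b1 \<union> r \<union> u0))"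
    using mover_spread[OF g(4) P(3,4), of s "b1 \<union> r \<union> u0"] fin finr fins finu0 by blast
  define v4 where "v4 = l4 ` s"
  have "ind v4 (Y \<union> b3) (s \<union> (b1 \<union> r \<union> u0))"
    using l4(2) unfolding v4_def by (rule ind_mono) auto
  then have "ind (b3 \<union> s \<union> v4) Y (b1 \<union> r \<union> u0)"
    by (intro ind_extend[OF ind_sym[OF I6], of v4 "Y \<union> b3" "s \<union> (b1 \<union> r \<union> u0)"]) auto
  then have "ind (b3 \<union> s \<union> v4) Y ((Y \<union> u0) \<union> (b1 \<union> r))"
    by (rule ind_absorb) auto
  then have I7: "ind ((Y \<union> u0) \<union> (b1 \<union> r)) Y ((b3 \<union> s) \<union> (Y \<union> v4))"
    by (rule ind_absorb[OF ind_sym]) auto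

  have autk: "k1 \<in> Aut M" "k2 \<in> Aut M"
    using k1(1) k2(1) aut by (auto intro: conjs_Aut)
  have autl: "l1' \<in> Aut M" "l2' \<in> Aut M" "l3 \<in> Aut M"
    using l1'(1) l2'(1) l3(1) autk aut3 by (blast intro: conjs_Aut Aut_inv)+
  \<comment> \<open>\<open>r\<close> and \<open>u0\<close> arose by pulling back, so
    \<open>l1'\<close> and \<open>l2'\<close> are conjugates of inverses and have to be
    inverted.\<close>
  define l1 l2 where "l1 = inv l1'" and "l2 = inv l2'"
  have c1: "l1 \<in> conjs M (Y \<union> b1) k1" and c2: "l2 \<in> conjs M S k2"
    using conjs_inv[OF l1'(1)] conjs_inv[OF l2'(1)] autk by (simp_all add: l1_def l2_def Aut_inv)
  have c3: "inv k3' \<in> conjs M Y g3"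
    using conjs_inv[OF k3'(1)] aut by (simp add: Aut_inv)
  have "l1 \<in> conjs M Y g1" "l2 \<in> conjs M Y g2" "l3 \<in> conjs M Y g3" "l4 \<in> conjs M Y g4"
    using conjs_trans[OF k1(1) conjs_mono[OF c1]] conjs_trans[OF k2(1) conjs_mono[OF c2]]
      conjs_trans[OF c3 conjs_mono[OF l3(1)]] conjs_mono[OF l4(1)]
    by (auto simp: S_def T_def)
  moreover have "b1 \<union> r = l1 ` (Y \<union> u0)"
    using conjs_image_eq[OF c1, of Y] autl by (simp add: u0_def l1_def b1_def)
  moreover have "u \<union> v \<union> Y = l2 ` (b1 \<union> r)"
  proof -
    have "l2 ` b1 = u"
      unfolding u_def by (rule conjs_image_eq[OF c2]) (auto simp: S_def u_def)
    then show ?thesis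
      using autl by (simp add: r_def l2_def Un_assoc)
  qed
  moreover have "b3 \<union> s = l3 ` (u \<union> v \<union> Y)"
    using conjs_image_eq[OF l3(1), of v] autl aut3 by (auto simp: s_def v_def T_def)
  moreover have "Y \<union> v4 = l4 ` (b3 \<union> s)"
    using conjs_image_eq[OF l4(1), of b3] aut by (auto simp: v4_def b3_def)
  ultimately show thesis
    by (rule that) (use Y finu0 I7 in auto)
qed

text \<open>The outer two maps bring \<open>A\<close> and \<open>f A\<close> into general position; this moves \<open>X1\<close> and \<open>X3\<close>, but
  independence and stationarity allow the chain to be moved along by an \<open>h\<close> fixing \<open>X0\<close> and \<open>X4\<close>.
  The inner two maps are then joined at an independent middle point.\<close>

lemma chain_extend:
  assumes g: "mover g1" "mover g2" "mover g3" "mover g4"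
    and X: "X1 = g1 ` X0" "X2 = g2 ` X1" "X3 = g3 ` X2" "X4 = g4 ` X3"
    and Y: "Y \<subseteq> X0" "Y \<subseteq> X2" "Y \<subseteq> X4" "ind (X0 \<union> X1) Y (X3 \<union> X4)"
    and f: "f \<in> Aut M" "\<And>x. x \<in> X0 \<Longrightarrow> f x = g4 (g3 (g2 (g1 x)))" and A: "finite A"
  obtains k1 k2 k3 k4 where
    "k1 \<in> conjs M Y g1" "k2 \<in> conjs M Y g2" "k3 \<in> conjs M Y g3" "k4 \<in> conjs M Y g4"
    "\<forall>x\<in>A. k4 (k3 (k2 (k1 x))) = f x"
proof -
  note aut = g[THEN mover_Aut] f(1)
  have fin: "finite X0" "finite X1" "finite X2" "finite X3" "finite X4" "finite Y"
      "X0 \<noteq> {}" "X1 \<noteq> {}" "X2 \<noteq> {}" "X3 \<noteq> {}" "X4 \<noteq> {}"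
    using Y X by (auto simp: ind_def)
  define A4 where "A4 = f ` A"
  have A4: "finite A4"
    using A by (simp add: A4_def)
  obtain k1 where k1: "k1 \<in> conjs M X0 g1" "ind (k1 ` A \<union> k1 ` X0) X0 (A \<union> (X4 \<union> A4))"
      "ind (k1 ` A) (k1 ` X0) (A \<union> X0)"
    using mover_spread[OF g(1), of X0 A "X4 \<union> A4"] fin A A4 by blast
  define B1 Z1 where "B1 = k1 ` A" and "Z1 = k1 ` X0"
  have finB1: "finite B1" "finite Z1" "Z1 \<noteq> {}"
    using fin A by (simp_all add: B1_def Z1_def)
  obtain k4' where k4': "k4' \<in> conjs M X4 (inv g4)"
      "ind (k4' ` A4 \<union> k4' ` X4) X4 (A4 \<union> (X0 \<union> A \<union> B1 \<union> Z1))"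
      "ind (k4' ` A4) (k4' ` X4) (A4 \<union> X4)"
    using mover_spread[OF mover_inv[OF g(4)], of X4 A4 "X0 \<union> A \<union> B1 \<union> Z1"] fin A A4 finB1 by blast
  define B3 Z3 where "B3 = k4' ` A4" and "Z3 = k4' ` X4"
  have I: "ind (B1 \<union> Z1) X0 (A \<union> (X4 \<union> A4))" "ind B1 Z1 (A \<union> X0)"
      "ind (B3 \<union> Z3) X4 (A4 \<union> (X0 \<union> A \<union> B1 \<union> Z1))" "ind B3 Z3 (A4 \<union> X4)"
    using k1 k4' by (simp_all add: B1_def Z1_def B3_def Z3_def)

  obtain a1 where a1: "a1 \<in> fixing M X0" "k1 = a1 \<circ> g1 \<circ> inv a1"
    using k1(1) by (auto simp: conjs_def)
  obtain a4 where a4: "a4 \<in> fixing M X4" "k4' = a4 \<circ> inv g4 \<circ> inv a4"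
    using k4'(1) by (auto simp: conjs_def)
  have k1X: "k1 x = a1 (g1 x)" if "x \<in> X0" for x
    using that a1 by (simp add: fixing_apply[OF fixing_inv])
  have k4X: "k4' x = a4 (inv g4 x)" if "x \<in> X4" for x
    using that a4 by (simp add: fixing_apply[OF fixing_inv])
  have Z1: "Z1 = a1 ` X1"
    unfolding Z1_def X image_image by (rule image_cong) (simp_all add: k1X)
  have "inv g4 ` X4 = X3"
    using aut by (simp add: X(4) image_image)
  then have Z3: "Z3 = a4 ` X3"
    using k4X by (auto simp: Z3_def image_image)

  \<comment> \<open>\<open>J1\<close> and \<open>J3\<close> give \<open>X1\<close> and
    \<open>X3\<close> the independence that \<open>I\<close> gives to \<open>Z1\<close> and
    \<open>Z3\<close>, as stationarity requires.\<close>
  have "ind (X3 \<union> X4) X0 X1"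
    by (rule ind_base[OF ind_sym[OF Y(4)]]) (use Y in auto)
  then have J1: "ind X1 X0 X4"
    by (rule ind_mono[OF ind_sym]) auto
  have "ind (X0 \<union> X1) X4 X3"
    by (rule ind_base[OF Y(4)]) (use Y in auto)
  then have J3: "ind X3 X4 (X0 \<union> X1)"
    by (rule ind_sym)
  have "ind (a1 ` X1) X0 X4"
    using I(1) by (rule ind_mono) (auto simp: Z1)
  from ind_stationary[OF a1(1) J1 this] obtain r1
    where r1: "r1 \<in> fixing M (X0 \<union> X4)" "\<And>x. x \<in> X1 \<Longrightarrow> r1 x = a1 x"
    by blast
  have auta: "a1 \<in> Aut M" "a4 \<in> Aut M" "r1 \<in> Aut M" "inv r1 \<in> Aut M"
    using a1(1) a4(1) r1(1) by (auto dest: fixing_Aut)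
  \<comment> \<open>Once \<open>r1\<close> has placed \<open>X1\<close> at \<open>Z1\<close>,
    \<open>t\<close> takes the displaced copy of \<open>X3\<close> to \<open>Z3\<close>.\<close>
  define t where "t = a4 \<circ> inv r1"
  have t: "t \<in> fixing M X4"
    unfolding t_def by (intro fixing_comp a4 fixing_inv fixing_mono[OF r1(1)]) auto
  have r1X: "r1 ` X1 = Z1" "r1 ` X0 = X0" "r1 ` X4 = X4"
    using fixing_image[OF r1(1)] r1(2) by (auto simp: Z1)
  have 1: "ind (r1 ` X3) X4 (X0 \<union> Z1)"
    using ind_image[OF J3 auta(3)] by (simp add: image_Un r1X)
  have "t ` r1 ` X3 = Z3"
    using auta by (simp add: t_def Z3 image_image)
  then have "ind (t ` r1 ` X3) X4 (X0 \<union> Z1)"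
    using ind_mono[OF I(3), of Z3 "X0 \<union> Z1"] by auto
  from ind_stationary[OF t 1 this] obtain r2 where
    r2: "r2 \<in> fixing M (X4 \<union> (X0 \<union> Z1))" "\<And>x. x \<in> r1 ` X3 \<Longrightarrow> r2 x = t x"
    by blast
  \<comment> \<open>With the outer sets in place, \<open>r3\<close> fixes them and frees the middle
    set from \<open>B1 \<union> B3\<close>.\<close>
  define Q where "Q = X0 \<union> X4 \<union> Z1 \<union> Z3"
  have Q: "finite Q" "Q \<noteq> {}" "finite (B1 \<union> B3)"
    using fin finB1 I(3) by (auto simp: Q_def ind_def)
  obtain r3 where r3: "r3 \<in> fixing M Q" "ind (r3 ` r2 ` r1 ` X2) Q (B1 \<union> B3)"
    using ind_exists[of "r2 ` r1 ` X2" Q "B1 \<union> B3"] Q fin by blast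
  define h where "h = r3 \<circ> (r2 \<circ> r1)"
  have "h \<in> fixing M (X0 \<union> X4)"
    unfolding h_def by (intro fixing_comp fixing_mono[OF r3(1)] fixing_mono[OF r2(1)] r1(1)) (auto simp: Q_def)
  then have hfix: "h \<in> fixing M Y"
    by (rule fixing_mono) (use Y in auto)
  then have h: "h \<in> Aut M"
    by (rule fixing_Aut)
  have hX1: "h x = a1 x" if "x \<in> X1" for x
  proof -
    have "a1 x \<in> Z1" using that by (auto simp: Z1)
    then show ?thesis
      using that by (simp add: h_def r1(2) fixing_apply[OF r2(1)] fixing_apply[OF r3(1)] Q_def)
  qed
  have hX3: "h x = a4 x" if "x \<in> X3" for x
  proof -
    have "r2 (r1 x) = a4 x"
      using that r2(2)[of "r1 x"] auta by (simp add: t_def)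
    moreover have "a4 x \<in> Z3"
      using that by (auto simp: Z3)
    ultimately show ?thesis
      by (simp add: h_def fixing_apply[OF r3(1)] Q_def)
  qed
  define Z2 where "Z2 = h ` X2"
  have Z2: "ind Z2 Q (B1 \<union> B3)"
    using r3(2) by (simp add: Z2_def h_def image_image)
  define k2 k3 where "k2 = h \<circ> g2 \<circ> inv h" and "k3 = h \<circ> g3 \<circ> inv h"
  have k23: "k2 \<in> conjs M Y g2" "k3 \<in> conjs M Y g3"
    unfolding k2_def k3_def by (intro conjsI hfix)+
  have mk: "mover k2" "mover k3"
    using k23 g by (auto intro: mover_conjs)
  note autk = mk[THEN mover_Aut]
  have hZ: "Z1 = h ` X1" "Z3 = h ` X3"
    using hX1 hX3 by (auto simp: Z1 Z3)
  have kZ: "k2 ` Z1 = Z2" "k3 ` Z2 = Z3"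
    using h by (simp_all add: k2_def k3_def hZ Z2_def X image_image)
  then have k3Z: "inv k3 ` Z3 = Z2"
    using autk by (auto simp: image_image)
  have "Y \<subseteq> Z2"
    using image_mono[OF Y(2), of h] fixing_image[OF hfix, of Y] by (simp add: Z2_def)

  \<comment> \<open>Over \<open>Z1\<close>, the set \<open>B1\<close> is freed from
    \<open>X0\<close> and \<open>A\<close>, then from \<open>X4\<close> and \<open>A4\<close>, then
    from \<open>Z3\<close>, and through \<open>Q\<close> from \<open>Z2\<close>; similarly for
    \<open>B3\<close> over \<open>Z3\<close>.\<close>
  have "ind (B1 \<union> Z1) (X0 \<union> A) (X4 \<union> A4)"
    by (rule ind_base[OF I(1)]) auto
  then have "ind (X4 \<union> A4) (X0 \<union> A \<union> Z1) B1"
    by (rule ind_base[OF ind_sym]) auto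
  then have "ind B1 Z1 (X0 \<union> A \<union> X4 \<union> A4)"
    by (rule ind_trans[OF I(2) ind_sym]) auto
  moreover have "ind (B3 \<union> Z3) (X0 \<union> A \<union> X4 \<union> A4 \<union> Z1) B1"
    by (rule ind_base[OF I(3)]) auto
  ultimately have K1: "ind B1 Z1 (X0 \<union> A \<union> X4 \<union> Z3)"
    by (rule ind_trans[OF _ ind_sym]) auto
  have "ind (B3 \<union> Z3) (X4 \<union> A4) (X0 \<union> A \<union> B1 \<union> Z1)"
    by (rule ind_base[OF I(3)]) auto
  then have "ind (X0 \<union> A \<union> B1 \<union> Z1) (X4 \<union> A4 \<union> Z3) B3"
    by (rule ind_base[OF ind_sym]) auto
  then have K3: "ind B3 Z3 (X4 \<union> A4 \<union> X0 \<union> Z1)"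
    by (rule ind_trans[OF I(4) ind_sym]) auto
  have "ind B1 Q Z2" "ind B3 Q Z2"
    using ind_mono[OF ind_sym[OF Z2]] by auto
  then have K1': "ind B1 Z1 Z2" and K3': "ind B3 Z3 Z2"
    using ind_trans[OF K1, of Q Z2 Z2] ind_trans[OF K3, of Q Z2 Z2] by (auto simp: Q_def)

  have autk14: "k1 \<in> Aut M" "k4' \<in> Aut M"
    using k1(1) k4'(1) aut by (auto intro: conjs_Aut Aut_inv)
  \<comment> \<open>The two inner maps together must act as \<open>k\<close> on \<open>B1\<close>.
    On \<open>Z1\<close> the maps \<open>k2\<close> and \<open>k3\<close> already do, since
    \<open>f\<close> agrees with the original product on \<open>X0\<close>.\<close>
  define k where "k = k4' \<circ> f \<circ> inv k1"
  have kAut: "k \<in> Aut M"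
    unfolding k_def using autk14 aut by auto
  have kZ1: "k z = k3 (k2 z)" if "z \<in> Z1" for z
  proof -
    from that obtain x where x: "x \<in> X0" "z = k1 x"
      by (auto simp: Z1_def)
    let ?y = "g3 (g2 (g1 x))"
    have "?y \<in> X3" "g4 ?y \<in> X4"
      using x X by auto
    then have "k z = a4 ?y"
      using x f(2) autk14 aut by (simp add: k_def k4X)
    also have "\<dots> = h ?y"
      using \<open>?y \<in> X3\<close> hX3 by simp
    also have "h (g1 x) = z"
      using x X hX1 k1X by simp
    then have "h ?y = k3 (k2 z)"
      using h by (auto simp: k2_def k3_def)
    finally show ?thesis .
  qed
  have finB: "finite (k2 ` B1)" "finite Z2" "Z2 \<noteq> {}" "finite (B1 \<union> Z1 \<union> B3 \<union> Z3)"
    using finB1 fin I(3) by (auto simp: Z2_def ind_def)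
  obtain s where s: "s \<in> fixing M Z2" "ind (s ` k2 ` B1) Z2 (B1 \<union> Z1 \<union> B3 \<union> Z3)"
    using ind_exists[OF finB(1,2,4,3)] by blast
  obtain l2 where l2: "l2 \<in> conjs M (Z1 \<union> Z2) k2" "\<And>x. x \<in> B1 \<Longrightarrow> l2 x = s (k2 x)"
  proof (rule mover_transport[OF mk(1), of s Z1 B1])
    show "ind (s ` k2 ` B1) (k2 ` Z1) (B1 \<union> Z1)"
      unfolding kZ using s(2) by (rule ind_mono) auto
  qed (use s K1' kZ in auto)
  \<comment> \<open>Chosen so that going back from \<open>k y\<close> reaches the same middle point
    \<open>s (k2 y)\<close> as going forward from \<open>y\<close>.\<close>
  define s3 where "s3 = s \<circ> k2 \<circ> inv k \<circ> k3"
  have sAut: "s \<in> Aut M"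
    using s(1) by (rule fixing_Aut)
  have s3: "s3 \<in> fixing M Z2"
  proof (rule fixingI)
    show "s3 \<in> Aut M"
      unfolding s3_def using sAut autk kAut by auto
    fix z assume z: "z \<in> Z2"
    then obtain y where y: "y \<in> Z1" "z = k2 y"
      using kZ by auto
    then have "inv k (k3 z) = y"
      using kZ1 kAut by (metis Aut_apply_inv(2))
    then show "s3 z = z"
      using y z fixing_apply[OF s(1)] by (simp add: s3_def)
  qed
  have kB1: "B3 = k ` B1"
    using autk14 by (simp add: B3_def A4_def B1_def k_def image_image)
  have s3B: "s3 (inv k3 (k y)) = s (k2 y)" for y
    using autk kAut by (simp add: s3_def)
  obtain l3' where l3': "l3' \<in> conjs M (Z3 \<union> Z2) (inv k3)"
      "\<And>x. x \<in> B3 \<Longrightarrow> l3' x = s3 (inv k3 x)"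
  proof (rule mover_transport[OF mover_inv[OF mk(2)], of s3 Z3 B3])
    have "s3 ` inv k3 ` B3 = s ` k2 ` B1"
      by (simp add: kB1 image_image s3B)
    then show "ind (s3 ` inv k3 ` B3) (inv k3 ` Z3) (B3 \<union> Z3)"
      unfolding k3Z using ind_mono[OF s(2)] by (metis Un_assoc Un_upper2 order_refl)
  qed (use s3 K3' k3Z in auto)
  have autl: "l3' \<in> Aut M"
    using l3'(1) autk by (blast intro: conjs_Aut Aut_inv)
  have "k1 \<in> conjs M Y g1"
    using k1(1) Y(1) by (rule conjs_mono)
  moreover have "l2 \<in> conjs M Y g2"
    by (rule conjs_trans[OF k23(1) conjs_mono[OF l2(1)]]) (use \<open>Y \<subseteq> Z2\<close> in auto)
  moreover have "inv l3' \<in> conjs M Y g3"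
  proof (rule conjs_trans[OF k23(2) conjs_mono])
    show "inv l3' \<in> conjs M (Z3 \<union> Z2) k3"
      using conjs_inv[OF l3'(1)] autk by (simp add: Aut_inv)
  qed (use \<open>Y \<subseteq> Z2\<close> in auto)
  moreover have "inv k4' \<in> conjs M Y g4"
    using conjs_inv[OF conjs_mono[OF k4'(1) Y(3)]] aut by (simp add: Aut_inv)
  moreover have "inv k4' (inv l3' (l2 (k1 x))) = f x" if "x \<in> A" for x
  proof -
    have y: "k1 x \<in> B1" "k (k1 x) \<in> B3"
      using that by (auto simp: B1_def kB1)
    then have "l3' (k (k1 x)) = l2 (k1 x)"
      by (simp add: l2(2) l3'(2) s3B)
    then have "inv l3' (l2 (k1 x)) = k (k1 x)"
      using autl by (metis Aut_apply_inv(2))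
    then show ?thesis
      using autk14 by (simp add: k_def)
  qed
  ultimately show thesis
    using that by blast
qed

end

subsection \<open>Successive approximation\<close>

text \<open>Injectivity and preservation of the structure involve finitely many points at a time and
  pass to the limit. Surjectivity does not, hence the hypothesis \<open>surj\<close>.\<close>

lemma Aut_limit:
  assumes h: "\<And>n. h n \<in> Aut M" and Y: "\<And>n. Y n \<subseteq> Y (Suc n)"
    and eq: "\<And>n y. y \<in> Y n \<Longrightarrow> h (Suc n) y = h n y"
    and ex: "\<And>y. \<exists>n. y \<in> Y n" and surj: "\<And>z. \<exists>n. z \<in> h n ` Y n"
  obtains k where "k \<in> Aut M" "\<And>n y. y \<in> Y n \<Longrightarrow> k y = h n y"
proof -
  have mono: "Y n \<subseteq> Y m" if "n \<le> m" for n m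
    using lift_Suc_mono_le[of Y] Y that by blast
  have stable: "h m y = h n y" if "n \<le> m" "y \<in> Y n" for n m y
    using that
  proof (induction rule: dec_induct)
    case (step m)
    then show ?case
      using eq[of y m] mono[of n m] by auto
  qed auto
  define k where "k y = h (LEAST n. y \<in> Y n) y" for y
  have k: "k y = h n y" if "y \<in> Y n" for n y
    unfolding k_def using stable[of "LEAST n. y \<in> Y n" n y] that
    by (metis LeastI_ex Least_le)
  have fin: "\<exists>n. F \<subseteq> Y n" if "finite F" for F
    using that
  proof induction
    case (insert x F)
    then obtain n m where "F \<subseteq> Y n" "x \<in> Y m"
      using ex by blast
    then show ?case
      using mono[of n "max n m"] mono[of m "max n m"] by (intro exI[of _ "max n m"]) auto
  qed auto
  have approx: "\<exists>n. k x = h n x \<and> map k xs = map (h n) xs" for x xs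
  proof -
    obtain n where "set (x # xs) \<subseteq> Y n"
      using fin by blast
    then show ?thesis
      by (intro exI[of _ n]) (auto simp: k)
  qed
  have "inj k"
  proof
    fix x y assume "k x = k y"
    moreover obtain n where "k x = h n x" "k y = h n y"
      using approx[of x "[y]"] by auto
    ultimately show "x = y"
      using Aut_eq_iff[OF h] by metis
  qed
  moreover have "\<exists>y. k y = z" for z
    using surj[of z] k by fastforce
  ultimately have "bij k"
    unfolding bij_def surj_def by metis
  moreover have "k (fun_interp M f xs) = fun_interp M f (map k xs)"
    if "f \<in> fun_syms M" "length xs = fun_arity M f" for f xs
  proof -
    obtain n where n: "k (fun_interp M f xs) = h n (fun_interp M f xs)" "map k xs = map (h n) xs"
      using approx by blast
    show ?thesis
      unfolding n using h[of n] that by (simp add: Aut_def)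
  qed
  moreover have "rel_interp M r (map k xs) \<longleftrightarrow> rel_interp M r xs"
    if "r \<in> rel_syms M" "length xs = rel_arity M r" for r xs
  proof -
    obtain n where n: "map k xs = map (h n) xs"
      using approx by blast
    show ?thesis
      unfolding n using h[of n] that by (simp add: Aut_def)
  qed
  ultimately have "k \<in> Aut M"
    by (simp add: Aut_def)
  then show thesis
    using k that by blast
qed

section \<open>Neighbourhoods of tuples and density of their images\<close>

definition agree :: "'a set \<Rightarrow> ('i \<Rightarrow> 'a \<Rightarrow> 'b) \<Rightarrow> ('i \<Rightarrow> 'a \<Rightarrow> 'b) \<Rightarrow> bool" where
  "agree Y h k \<longleftrightarrow> (\<forall>i. \<forall>y\<in>Y. h i y = k i y)"

definition tuples :: "('a, 'f, 'r) fo_structure \<Rightarrow> ('i \<Rightarrow> 'a \<Rightarrow> 'a) set" where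
  "tuples M = {h. \<forall>i. h i \<in> Aut M}"

text \<open>The image of the basic neighbourhood of \<open>h\<close> given by \<open>Y\<close> is dense in the basic neighbourhood
  of \<open>w\<close> given by \<open>X\<close>.\<close>

definition dense_image ::
    "('a, 'f, 'r) fo_structure \<Rightarrow> (('i \<Rightarrow> 'a \<Rightarrow> 'a) \<Rightarrow> 'a \<Rightarrow> 'a) \<Rightarrow>
     ('i \<Rightarrow> 'a \<Rightarrow> 'a) \<Rightarrow> 'a set \<Rightarrow> ('a \<Rightarrow> 'a) \<Rightarrow> 'a set \<Rightarrow> bool" where
  "dense_image M \<Phi> h Y w X \<longleftrightarrow>
     (\<forall>t\<in>Aut M. (\<forall>x\<in>X. t x = w x) \<longrightarrow>
        (\<forall>A. finite A \<longrightarrow> (\<exists>k\<in>tuples M. agree Y k h \<and> (\<forall>x\<in>A. \<Phi> k x = t x))))"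

text \<open>Stronger than the name suggests: the image of every basic neighbourhood has to be dense
  in some basic open set.\<close>

definition somewhere_dense ::
    "('a, 'f, 'r) fo_structure \<Rightarrow> (('i \<Rightarrow> 'a \<Rightarrow> 'a) \<Rightarrow> 'a \<Rightarrow> 'a) \<Rightarrow> bool" where
  "somewhere_dense M \<Phi> \<longleftrightarrow>
     (\<forall>h\<in>tuples M. \<forall>Y. finite Y \<longrightarrow> (\<exists>w\<in>Aut M. \<exists>X. finite X \<and> dense_image M \<Phi> h Y w X))"

definition ptwise_cont ::
    "('a, 'f, 'r) fo_structure \<Rightarrow> (('i \<Rightarrow> 'a \<Rightarrow> 'a) \<Rightarrow> 'a \<Rightarrow> 'a) \<Rightarrow> bool" where
  "ptwise_cont M \<Phi> \<longleftrightarrow>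
     (\<forall>h\<in>tuples M. \<forall>A. finite A \<longrightarrow>
        (\<exists>Y. finite Y \<and> (\<forall>k\<in>tuples M. agree Y k h \<longrightarrow> (\<forall>x\<in>A. \<Phi> k x = \<Phi> h x))))"

lemma tuples_Aut: "h \<in> tuples M \<Longrightarrow> h i \<in> Aut M"
  by (simp add: tuples_def)

lemma agree_mono: "agree Y h k \<Longrightarrow> X \<subseteq> Y \<Longrightarrow> agree X h k"
  by (auto simp: agree_def)

lemma dense_image_cong:
  "dense_image M \<Phi> h Y w X \<Longrightarrow> (\<And>x. x \<in> X \<Longrightarrow> v x = w x) \<Longrightarrow> dense_image M \<Phi> h Y v X"
  by (simp add: dense_image_def)

lemma dense_imageE:
  assumes "dense_image M \<Phi> h Y w X" "t \<in> Aut M" "\<And>x. x \<in> X \<Longrightarrow> t x = w x" "finite A"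
  obtains k where "k \<in> tuples M" "agree Y k h" "\<forall>x\<in>A. \<Phi> k x = t x"
proof -
  have "\<exists>k\<in>tuples M. agree Y k h \<and> (\<forall>x\<in>A. \<Phi> k x = t x)"
    using assms(1)[unfolded dense_image_def, rule_format, OF assms(2) assms(3) assms(4)] .
  then show thesis
    using that by auto
qed

text \<open>Density gives a \<open>k\<close> with the values of \<open>w\<close> on
  \<open>E\<close>, and continuity gives a neighbourhood of \<open>k\<close> on which these values
  are constant. The image of that neighbourhood is dense near some \<open>w'\<close>, which
  therefore equals \<open>w\<close> on \<open>E\<close>.\<close>

lemma refine_neighbourhood:
  fixes h :: "'i::finite \<Rightarrow> 'a \<Rightarrow> 'a"
  assumes \<Phi>: "somewhere_dense M \<Phi>" "ptwise_cont M \<Phi>"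
    and w: "dense_image M \<Phi> h Y w X" "w \<in> Aut M" and fin: "finite Y" "finite E"
  obtains k Y' w' X' where
    "k \<in> tuples M" "agree Y k h" "Y \<subseteq> Y'" "finite Y'" "E \<subseteq> Y'" "\<forall>i. E \<subseteq> k i ` Y'"
    "w' \<in> Aut M" "\<forall>x\<in>E. w' x = w x" "finite X'" "dense_image M \<Phi> k Y' w' X'"
    "\<forall>l\<in>tuples M. agree Y' l k \<longrightarrow> (\<forall>x\<in>E. \<Phi> l x = w x)"
proof -
  obtain k where k: "k \<in> tuples M" "agree Y k h" "\<forall>x\<in>E. \<Phi> k x = w x"
    by (rule dense_imageE[OF w refl fin(2)])
  obtain Y1 where Y1: "finite Y1"
      "\<forall>l\<in>tuples M. agree Y1 l k \<longrightarrow> (\<forall>x\<in>E. \<Phi> l x = \<Phi> k x)"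
    using \<Phi>(2)[unfolded ptwise_cont_def, rule_format, OF k(1) fin(2)] by blast
  \<comment> \<open>\<open>E\<close> and its preimages are included so that the limit is defined
    everywhere and surjective.\<close>
  define Y' where "Y' = Y \<union> Y1 \<union> E \<union> (\<Union>i. inv (k i) ` E)"
  have Y': "finite Y'"
    using Y1 fin by (simp add: Y'_def)
  have cont: "\<Phi> l x = w x" if "l \<in> tuples M" "agree Y' l k" "x \<in> E" for l x
  proof -
    have "agree Y1 l k"
      using that(2) by (rule agree_mono) (auto simp: Y'_def)
    then show ?thesis
      using Y1(2) k(3) that(1,3) by simp
  qed
  obtain w' X' where w': "w' \<in> Aut M" "finite X'" "dense_image M \<Phi> k Y' w' X'"
    using \<Phi>(1)[unfolded somewhere_dense_def, rule_format, OF k(1) Y'] by blast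
  obtain l where l: "l \<in> tuples M" "agree Y' l k" "\<forall>x\<in>E. \<Phi> l x = w' x"
    by (rule dense_imageE[OF w'(3,1) refl fin(2)])
  have EY: "\<forall>i. E \<subseteq> k i ` Y'"
  proof (intro allI subsetI)
    fix i x assume "x \<in> E"
    then have "inv (k i) x \<in> Y'"
      by (auto simp: Y'_def)
    moreover have "x = k i (inv (k i) x)"
      using tuples_Aut[OF k(1), of i] by simp
    ultimately show "x \<in> k i ` Y'"
      by blast
  qed
  have w'w: "w' x = w x" if "x \<in> E" for x
    using l(3) cont[OF l(1,2)] that by simp
  have sub: "Y \<subseteq> Y'" "E \<subseteq> Y'"
    by (auto simp: Y'_def)
  show thesis
    using that[OF k(1,2) sub(1) Y' sub(2) EY w'(1) _ w'(2,3)] w'w cont by blast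
qed

lemma tuples_limit:
  fixes h :: "nat \<Rightarrow> 'i \<Rightarrow> 'a \<Rightarrow> 'a"
  assumes h: "\<And>n. h n \<in> tuples M" and Y: "\<And>n. Y n \<subseteq> Y (Suc n)"
    and eq: "\<And>n. agree (Y n) (h (Suc n)) (h n)"
    and e: "range e = UNIV" "\<And>n. e n \<in> Y (Suc n)" "\<And>n i. e n \<in> h (Suc n) i ` Y (Suc n)"
  obtains k where "k \<in> tuples M" "\<And>n. agree (Y n) k (h n)"
proof -
  have ee: "\<exists>n. z = e n" for z
    using e(1) by blast
  have "\<exists>k. k \<in> Aut M \<and> (\<forall>n. \<forall>y\<in>Y n. k y = h n i y)" for i
  proof (rule Aut_limit[of "\<lambda>n. h n i" M Y])
    show "\<exists>n. y \<in> Y n" for y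
      using ee[of y] e(2) by blast
    show "\<exists>n. z \<in> h n i ` Y n" for z
      using ee[of z] e(3) by blast
  qed (use Y eq h in \<open>auto simp: agree_def tuples_def\<close>)
  then obtain k where "\<And>i. k i \<in> Aut M \<and> (\<forall>n. \<forall>y\<in>Y n. k i y = h n i y)"
    by metis
  then show thesis
    using that[of k] by (auto simp: tuples_def agree_def)
qed

text \<open>Replaces the Baire category theorem: the open sets in which the images of shrinking
  neighbourhoods under the two maps are dense are kept overlapping, so that the images of the limits
  coincide.\<close>

lemma images_meet:
  fixes \<Phi> \<Psi> :: "('i::finite \<Rightarrow> 'a \<Rightarrow> 'a) \<Rightarrow> 'a \<Rightarrow> 'a"
  assumes count: "countable (UNIV :: 'a set)"
    and \<Phi>: "somewhere_dense M \<Phi>" "ptwise_cont M \<Phi>"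
    and \<Psi>: "somewhere_dense M \<Psi>" "ptwise_cont M \<Psi>"
    and start: "h0 \<in> tuples M" "dense_image M \<Phi> h0 {} w0 X0" "finite X0"
      "k0 \<in> tuples M" "dense_image M \<Psi> k0 {} w0 Z0" "finite Z0" "w0 \<in> Aut M"
  obtains h k where "h \<in> tuples M" "k \<in> tuples M" "\<Phi> h = \<Psi> k"
proof -
  define e :: "nat \<Rightarrow> 'a" where "e = from_nat_into UNIV"
  have e: "range e = UNIV"
    using count by (simp add: e_def range_from_nat_into)
  \<comment> \<open>The common \<open>w\<close> witnesses that the two basic open sets
    overlap.\<close>
  define P where "P = (\<lambda>(h, Y, X, k, V, Z, w). h \<in> tuples M \<and> k \<in> tuples M \<and> w \<in> Aut M \<and>
    finite Y \<and> finite X \<and> finite V \<and> finite Z \<and>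
    dense_image M \<Phi> h Y w X \<and> dense_image M \<Psi> k V w Z)"
  define R where "R = (\<lambda>n (h, Y, X :: 'a set, k, V, Z :: 'a set, w :: 'a \<Rightarrow> 'a)
      (h', Y', X' :: 'a set, k', V', Z' :: 'a set, w' :: 'a \<Rightarrow> 'a).
    agree Y h' h \<and> Y \<subseteq> Y' \<and> e n \<in> Y' \<and> (\<forall>i. e n \<in> h' i ` Y') \<and>
    agree V k' k \<and> V \<subseteq> V' \<and> e n \<in> V' \<and> (\<forall>i. e n \<in> k' i ` V') \<and>
    (\<forall>l\<in>tuples M. agree Y' l h' \<longrightarrow> \<Phi> l (e n) = w (e n)) \<and>
    (\<forall>l\<in>tuples M. agree V' l k' \<longrightarrow> \<Psi> l (e n) = w (e n)))"
  have step: "\<exists>s'. P s' \<and> R n s s'" if "P s" for n s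
  proof -
    obtain h Y X k V Z w where s: "s = (h, Y, X, k, V, Z, w)"
      by (metis prod.exhaust)
    then have p: "h \<in> tuples M" "k \<in> tuples M" "w \<in> Aut M" "finite Y" "finite X" "finite V" "finite Z"
        "dense_image M \<Phi> h Y w X" "dense_image M \<Psi> k V w Z"
      using \<open>P s\<close> by (simp_all add: P_def)
    \<comment> \<open>Including \<open>Z\<close> keeps the new \<open>w'\<close> in the open set
      belonging to \<open>\<Psi>\<close>; below, \<open>X'\<close> serves the same purpose for
      \<open>\<Phi>\<close>.\<close>
    have fin1: "finite (insert (e n) Z)"
      using p by simp
    obtain h' Y' w' X' where 1: "h' \<in> tuples M" "agree Y h' h" "Y \<subseteq> Y'" "finite Y'"
      "insert (e n) Z \<subseteq> Y'" "\<forall>i. insert (e n) Z \<subseteq> h' i ` Y'"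
      "w' \<in> Aut M" "\<forall>x\<in>insert (e n) Z. w' x = w x" "finite X'" "dense_image M \<Phi> h' Y' w' X'"
      "\<forall>l\<in>tuples M. agree Y' l h' \<longrightarrow> (\<forall>x\<in>insert (e n) Z. \<Phi> l x = w x)"
      by (rule refine_neighbourhood[OF \<Phi> p(8,3,4) fin1])
    have d: "dense_image M \<Psi> k V w' Z"
      by (rule dense_image_cong[OF p(9)]) (use 1(8) in simp)
    have fin2: "finite (insert (e n) X')"
      using 1 by simp
    obtain k' V' v Z' where 2: "k' \<in> tuples M" "agree V k' k" "V \<subseteq> V'" "finite V'"
      "insert (e n) X' \<subseteq> V'" "\<forall>i. insert (e n) X' \<subseteq> k' i ` V'"
      "v \<in> Aut M" "\<forall>x\<in>insert (e n) X'. v x = w' x" "finite Z'" "dense_image M \<Psi> k' V' v Z'"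
      "\<forall>l\<in>tuples M. agree V' l k' \<longrightarrow> (\<forall>x\<in>insert (e n) X'. \<Psi> l x = w' x)"
      by (rule refine_neighbourhood[OF \<Psi> d 1(7) p(6) fin2])
    have "dense_image M \<Phi> h' Y' v X'"
      by (rule dense_image_cong[OF 1(10)]) (use 2(8) in simp)
    then have "P (h', Y', X', k', V', Z', v)"
      using 1 2 by (simp add: P_def)
    moreover have "R n s (h', Y', X', k', V', Z', v)"
      unfolding s R_def using 1(2,3,5,6,8,11) 2(2,3,5,6,11) by auto
    ultimately show ?thesis
      by blast
  qed
  have "\<exists>s. P s"
    using start by (intro exI[of _ "(h0, {}, X0, k0, {}, Z0, w0)"]) (simp add: P_def)
  then obtain s where s: "\<And>n. P (s n)" "\<And>n. R n (s n) (s (Suc n))"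
    using dependent_nat_choice[of "\<lambda>_. P" R] step by metis
  define h Y k V w where "h n = fst (s n)" and "Y n = fst (snd (s n))"
    and "k n = fst (snd (snd (snd (s n))))" and "V n = fst (snd (snd (snd (snd (s n)))))"
    and "w n = snd (snd (snd (snd (snd (snd (s n))))))" for n
  have hk: "h n \<in> tuples M" "k n \<in> tuples M" for n
    using s(1)[of n] by (auto simp: P_def h_def k_def split: prod.splits)
  have RR: "agree (Y n) (h (Suc n)) (h n)" "Y n \<subseteq> Y (Suc n)" "e n \<in> Y (Suc n)"
     "\<And>i. e n \<in> h (Suc n) i ` Y (Suc n)"
     "agree (V n) (k (Suc n)) (k n)" "V n \<subseteq> V (Suc n)" "e n \<in> V (Suc n)"
     "\<And>i. e n \<in> k (Suc n) i ` V (Suc n)"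
     "\<And>l. l \<in> tuples M \<Longrightarrow> agree (Y (Suc n)) l (h (Suc n)) \<Longrightarrow> \<Phi> l (e n) = w n (e n)"
     "\<And>l. l \<in> tuples M \<Longrightarrow> agree (V (Suc n)) l (k (Suc n)) \<Longrightarrow> \<Psi> l (e n) = w n (e n)" for n
    using s(2)[of n] by (auto simp: R_def h_def Y_def k_def V_def w_def split: prod.splits)
  obtain hl where hl: "hl \<in> tuples M" "\<And>n. agree (Y n) hl (h n)"
    using tuples_limit[of h M Y e] hk(1) RR(1-4) e by metis
  obtain kl where kl: "kl \<in> tuples M" "\<And>n. agree (V n) kl (k n)"
    using tuples_limit[of k M V e] hk(2) RR(5-8) e by metis
  have "\<Phi> hl (e n) = \<Psi> kl (e n)" for n
    using RR(9)[OF hl(1,2)] RR(10)[OF kl(1,2)] by simp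
  then have "\<Phi> hl = \<Psi> kl"
    using e by (metis ext surj_def)
  with hl(1) kl(1) show thesis
    by (rule that)
qed

subsection \<open>Products of four conjugates\<close>

definition conj_by :: "('a \<Rightarrow> 'a) \<Rightarrow> ('a \<Rightarrow> 'a) \<Rightarrow> 'a \<Rightarrow> 'a" where
  "conj_by g k = k \<circ> g \<circ> inv k"

text \<open>\<open>bool \<times> bool\<close> serves as a finite index type with four elements; the
  factor at \<open>(False, False)\<close> acts first.\<close>

definition conj_prod :: "('a \<Rightarrow> 'a) \<Rightarrow> (bool \<times> bool \<Rightarrow> 'a \<Rightarrow> 'a) \<Rightarrow> 'a \<Rightarrow> 'a" where
  "conj_prod g h = conj_by g (h (True, True)) \<circ> (conj_by g (h (True, False)) \<circ>
     (conj_by g (h (False, True)) \<circ> conj_by g (h (False, False))))"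

lemma conj_by_Aut: "g \<in> Aut M \<Longrightarrow> k \<in> Aut M \<Longrightarrow> conj_by g k \<in> Aut M"
  unfolding conj_by_def by blast

lemma conj_by_conj_class: "k \<in> Aut M \<Longrightarrow> conj_by g k \<in> conj_class M g"
  by (auto simp: conj_by_def conj_class_def)

lemma conj_by_comp:
  "h \<in> Aut M \<Longrightarrow> k \<in> Aut M \<Longrightarrow> conj_by g (h \<circ> k) = h \<circ> conj_by g k \<circ> inv h"
  by (simp add: conj_by_def inv_Aut_comp o_assoc)

lemma conj_prod_Aut: "g \<in> Aut M \<Longrightarrow> h \<in> tuples M \<Longrightarrow> conj_prod g h \<in> Aut M"
  unfolding conj_prod_def by (intro Aut_comp conj_by_Aut tuples_Aut[of h])

text \<open>Makes the set of products of four conjugates invariant under conjugation.\<close>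

lemma conj_prod_comp:
  assumes "h \<in> Aut M" "k \<in> tuples M"
  shows "conj_prod g (\<lambda>i. h \<circ> k i) = h \<circ> conj_prod g k \<circ> inv h"
  using assms tuples_Aut[OF assms(2)]
  by (simp add: conj_prod_def conj_by_comp[of h M] fun_eq_iff)

lemma ptwise_cont_conj_by:
  fixes g :: "'a \<Rightarrow> 'a" and i :: 'i
  assumes "g \<in> Aut M" shows "ptwise_cont M (\<lambda>h. conj_by g (h i))"
  unfolding ptwise_cont_def
proof (intro ballI allI impI)
  fix h :: "'i \<Rightarrow> 'a \<Rightarrow> 'a" and A :: "'a set" assume h: "h \<in> tuples M" "finite A"
  \<comment> \<open>Agreement on the first set fixes the values of \<open>inv (k i)\<close> on
    \<open>A\<close>; the second set then covers the outer application of
    \<open>k i\<close>.\<close>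
  let ?Y = "inv (h i) ` A \<union> g ` inv (h i) ` A"
  have "conj_by g (k i) x = conj_by g (h i) x"
    if k: "k \<in> tuples M" and a: "agree ?Y k h" and x: "x \<in> A" for k x
  proof -
    have "k i (inv (h i) x) = x"
      using a x tuples_Aut[OF h(1), of i] by (simp add: agree_def)
    then have "inv (k i) x = inv (h i) x"
      using tuples_Aut[OF k] Aut_inv_eqI by metis
    then show ?thesis
      using a x by (simp add: agree_def conj_by_def)
  qed
  then show "\<exists>Y. finite Y \<and> (\<forall>k\<in>tuples M. agree Y k h \<longrightarrow> (\<forall>x\<in>A. conj_by g (k i) x = conj_by g (h i) x))"
    using h(2) by (intro exI[of _ ?Y]) auto
qed

lemma ptwise_cont_comp:
  fixes \<Phi> \<Psi> :: "('i \<Rightarrow> 'a \<Rightarrow> 'a) \<Rightarrow> 'a \<Rightarrow> 'a"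
  assumes "ptwise_cont M \<Phi>" "ptwise_cont M \<Psi>"
  shows "ptwise_cont M (\<lambda>h. \<Phi> h \<circ> \<Psi> h)"
  unfolding ptwise_cont_def
proof (intro ballI allI impI)
  fix h :: "'i \<Rightarrow> 'a \<Rightarrow> 'a" and A :: "'a set" assume h: "h \<in> tuples M" "finite A"
  obtain Y where Y: "finite Y" "\<forall>k\<in>tuples M. agree Y k h \<longrightarrow> (\<forall>x\<in>A. \<Psi> k x = \<Psi> h x)"
    using assms(2)[unfolded ptwise_cont_def, rule_format, OF h] by blast
  obtain Z where Z: "finite Z"
      "\<forall>k\<in>tuples M. agree Z k h \<longrightarrow> (\<forall>x\<in>\<Psi> h ` A. \<Phi> k x = \<Phi> h x)"
    using assms(1)[unfolded ptwise_cont_def, rule_format, OF h(1) finite_imageI[OF h(2)]] by blast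
  show "\<exists>Y. finite Y \<and> (\<forall>k\<in>tuples M. agree Y k h \<longrightarrow> (\<forall>x\<in>A. (\<Phi> k \<circ> \<Psi> k) x = (\<Phi> h \<circ> \<Psi> h) x))"
    using Y Z by (intro exI[of _ "Y \<union> Z"]) (auto simp: agree_def)
qed

lemma ptwise_cont_conj_prod: "g \<in> Aut M \<Longrightarrow> ptwise_cont M (conj_prod g)"
  unfolding conj_prod_def[abs_def] by (intro ptwise_cont_comp ptwise_cont_conj_by)

section \<open>Transfer to the map \<open>h \<mapsto> f \<circ> inv (\<Phi> h)\<close>\<close>

lemma inv_eq_on_image:
  assumes "u \<in> Aut M" "v \<in> Aut M" "u (inv v x) = v (inv v x)" shows "inv u x = inv v x"
  using assms by (intro Aut_inv_eqI[of u M]) auto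

lemma ptwise_cont_comp_inv:
  fixes \<Phi> :: "('i \<Rightarrow> 'a \<Rightarrow> 'a) \<Rightarrow> 'a \<Rightarrow> 'a"
  assumes "ptwise_cont M \<Phi>" "\<And>h. h \<in> tuples M \<Longrightarrow> \<Phi> h \<in> Aut M"
  shows "ptwise_cont M (\<lambda>h. f \<circ> inv (\<Phi> h))"
  unfolding ptwise_cont_def
proof (intro ballI allI impI)
  fix h :: "'i \<Rightarrow> 'a \<Rightarrow> 'a" and A :: "'a set" assume h: "h \<in> tuples M" "finite A"
  obtain Y where Y: "finite Y"
      "\<forall>k\<in>tuples M. agree Y k h \<longrightarrow> (\<forall>x\<in>inv (\<Phi> h) ` A. \<Phi> k x = \<Phi> h x)"
    using assms(1)[unfolded ptwise_cont_def, rule_format, OF h(1) finite_imageI[OF h(2)]] by blast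
  have "inv (\<Phi> k) x = inv (\<Phi> h) x" if "k \<in> tuples M" "agree Y k h" "x \<in> A" for k x
  proof (rule inv_eq_on_image[OF assms(2)[OF that(1)] assms(2)[OF h(1)]])
    show "\<Phi> k (inv (\<Phi> h) x) = \<Phi> h (inv (\<Phi> h) x)"
      using Y(2) that by blast
  qed
  then show "\<exists>Y. finite Y \<and>
      (\<forall>k\<in>tuples M. agree Y k h \<longrightarrow> (\<forall>x\<in>A. (f \<circ> inv (\<Phi> k)) x = (f \<circ> inv (\<Phi> h)) x))"
    using Y(1) by (intro exI[of _ Y]) simp
qed

text \<open>To approximate \<open>t\<close>, approximate \<open>inv t \<circ> f\<close> by the
  original map, on the preimage of \<open>A\<close>.\<close>

lemma dense_image_comp_inv:
  assumes d: "dense_image M \<Phi> h Y w X" and \<Phi>: "\<And>h. h \<in> tuples M \<Longrightarrow> \<Phi> h \<in> Aut M"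
    and aut: "w \<in> Aut M" "f \<in> Aut M"
  shows "dense_image M (\<lambda>h. f \<circ> inv (\<Phi> h)) h Y (f \<circ> inv w) (w ` X)"
  unfolding dense_image_def
proof (intro ballI allI impI)
  fix t and A :: "'a set" assume t: "t \<in> Aut M" "\<forall>x\<in>w ` X. t x = (f \<circ> inv w) x" and A: "finite A"
  define p where "p = inv t \<circ> f"
  have p: "p \<in> Aut M"
    unfolding p_def using t aut by blast
  have "p x = w x" if "x \<in> X" for x
    using t that aut by (auto simp: p_def intro: Aut_inv_eqI)
  then obtain k where k: "k \<in> tuples M" "agree Y k h" "\<forall>x\<in>inv p ` A. \<Phi> k x = p x"
    by (rule dense_imageE[OF d p _ finite_imageI[OF A]])
  have "(f \<circ> inv (\<Phi> k)) x = t x" if "x \<in> A" for x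
  proof -
    have "inv (\<Phi> k) x = inv p x"
      using inv_eq_on_image[OF \<Phi>[OF k(1)] p, of x] k(3) that by blast
    moreover have "inv p x = inv f (t x)"
      using p t(1) aut by (intro Aut_inv_eqI[OF p]) (simp add: p_def)
    ultimately show ?thesis
      using aut by simp
  qed
  with k show "\<exists>k\<in>tuples M. agree Y k h \<and> (\<forall>x\<in>A. (f \<circ> inv (\<Phi> k)) x = t x)"
    by blast
qed

lemma somewhere_dense_comp_inv:
  fixes \<Phi> :: "('i \<Rightarrow> 'a \<Rightarrow> 'a) \<Rightarrow> 'a \<Rightarrow> 'a"
  assumes "somewhere_dense M \<Phi>" "\<And>h. h \<in> tuples M \<Longrightarrow> \<Phi> h \<in> Aut M" "f \<in> Aut M"
  shows "somewhere_dense M (\<lambda>h. f \<circ> inv (\<Phi> h))"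
  unfolding somewhere_dense_def
proof (intro ballI allI impI)
  fix h :: "'i \<Rightarrow> 'a \<Rightarrow> 'a" and Y :: "'a set" assume "h \<in> tuples M" "finite Y"
  then obtain w X where w: "w \<in> Aut M" "finite X" "dense_image M \<Phi> h Y w X"
    using assms(1) unfolding somewhere_dense_def by blast
  have "f \<circ> inv w \<in> Aut M"
    using w(1) assms(3) by blast
  with w dense_image_comp_inv[OF w(3) assms(2) w(1) assms(3)]
  show "\<exists>w\<in>Aut M. \<exists>X. finite X \<and> dense_image M (\<lambda>h. f \<circ> inv (\<Phi> h)) h Y w X"
    by blast
qed

text \<open>The empty neighbourhood condition matters: composing all conjugators with
  \<open>k\<close> preserves the set of all tuples but not a smaller neighbourhood.\<close>

lemma dense_image_conj_prod:
  assumes d: "dense_image M (conj_prod g) h {} w X" and aut: "k \<in> Aut M" "g \<in> Aut M"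
  shows "dense_image M (conj_prod g) h {} (k \<circ> w \<circ> inv k) (k ` X)"
  unfolding dense_image_def
proof (intro ballI allI impI)
  fix t and A :: "'a set" assume t: "t \<in> Aut M" "\<forall>x\<in>k ` X. t x = (k \<circ> w \<circ> inv k) x" and A: "finite A"
  define p where "p = inv k \<circ> t \<circ> k"
  have p: "p \<in> Aut M"
    unfolding p_def using t aut by blast
  have "p x = w x" if "x \<in> X" for x
    using t that aut by (simp add: p_def)
  then obtain l where l: "l \<in> tuples M" "\<forall>x\<in>inv k ` A. conj_prod g l x = p x"
    by (rule dense_imageE[OF d p _ finite_imageI[OF A]])
  have "conj_prod g (\<lambda>i. k \<circ> l i) x = t x" if "x \<in> A" for x
    using that l(2) aut by (simp add: conj_prod_comp[OF aut(1) l(1)] p_def)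
  moreover have "(\<lambda>i. k \<circ> l i) \<in> tuples M"
    using l(1) aut by (auto simp: tuples_def)
  ultimately show "\<exists>l\<in>tuples M. agree {} l h \<and> (\<forall>x\<in>A. conj_prod g l x = t x)"
    by (auto simp: agree_def)
qed

lemma dense_conj_class_meets:
  assumes "aut_topology M closure_of conj_class M d = topspace (aut_topology M)"
    and "w \<in> Aut M" "finite X"
  obtains k where "k \<in> Aut M" "\<forall>x\<in>X. conj_by d k x = w x"
proof -
  let ?U = "{h \<in> Aut M. \<forall>x\<in>X. h x = w x}"
  have "openin (aut_topology M) ?U"
    unfolding openin_aut_topology_iff
  proof (intro conjI ballI exI)
    show "{h \<in> Aut M. \<forall>x\<in>X. h x = k x} \<subseteq> ?U" if "k \<in> ?U" for k
      using that by simp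
  qed (use assms(3) in auto)
  moreover have "w \<in> aut_topology M closure_of conj_class M d"
    using assms by simp
  moreover have "w \<in> ?U"
    using assms(2) by simp
  ultimately have "\<exists>c. c \<in> conj_class M d \<and> c \<in> ?U"
    by (simp only: in_closure_of)
  then obtain k where "k \<in> Aut M" "conj_by d k \<in> ?U"
    by (auto simp: conj_class_def conj_by_def)
  then show thesis
    by (intro that[of k]) simp_all
qed

context local_stationary_independence
begin

text \<open>\<open>spread_chain\<close> brings the factors into general position over a finite set,
  and \<open>chain_extend\<close> then approximates every automorphism agreeing with their product
  on \<open>X0\<close>.\<close>

lemma somewhere_dense_conj_prod:
  assumes "mover g"
  shows "somewhere_dense M (conj_prod g)"
  unfolding somewhere_dense_def
proof (intro ballI allI impI)
  fix h :: "bool \<times> bool \<Rightarrow> 'a \<Rightarrow> 'a" and Y :: "'a set"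
  assume h: "h \<in> tuples M" and "finite Y"
  \<comment> \<open>New conjugators have the form \<open>a \<circ> h i\<close> with \<open>a\<close>
    fixing \<open>V\<close>, so they agree with \<open>h i\<close> on \<open>Y\<close>. The point
    \<open>undefined\<close> only keeps the base non-empty.\<close>
  define V where "V = insert undefined (\<Union>i. h i ` Y)"
  have V: "finite V" "V \<noteq> {}"
    using \<open>finite Y\<close> by (simp_all add: V_def)
  have mover_h: "mover (conj_by g (h i))" for i
    unfolding conj_by_def using assms tuples_Aut[OF h] by (rule mover_conj)
  obtain k1 k2 k3 k4 X0 X1 X2 X3 X4 where k:
      "k1 \<in> conjs M V (conj_by g (h (False, False)))" "k2 \<in> conjs M V (conj_by g (h (False, True)))"
      "k3 \<in> conjs M V (conj_by g (h (True, False)))" "k4 \<in> conjs M V (conj_by g (h (True, True)))"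
    and X: "X1 = k1 ` X0" "X2 = k2 ` X1" "X3 = k3 ` X2" "X4 = k4 ` X3"
    and VX: "V \<subseteq> X0" "V \<subseteq> X2" "V \<subseteq> X4" and fin: "finite X0" and I: "ind (X0 \<union> X1) V (X3 \<union> X4)"
    by (rule spread_chain[OF mover_h mover_h mover_h mover_h V])
  have mk: "mover k1" "mover k2" "mover k3" "mover k4"
    using k by (auto intro: mover_conjs[OF mover_h])
  define w where "w = k4 \<circ> (k3 \<circ> (k2 \<circ> k1))"
  have w: "w \<in> Aut M"
    unfolding w_def by (intro Aut_comp mk[THEN mover_Aut])
  have "dense_image M (conj_prod g) h Y w X0"
    unfolding dense_image_def
  proof (intro ballI allI impI)
    fix f and A :: "'a set" assume f: "f \<in> Aut M" "\<forall>x\<in>X0. f x = w x" and A: "finite A"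
    have f0: "f x = k4 (k3 (k2 (k1 x)))" if "x \<in> X0" for x
      using f(2) that by (simp add: w_def)
    obtain l1 l2 l3 l4 where
      l: "l1 \<in> conjs M V k1" "l2 \<in> conjs M V k2" "l3 \<in> conjs M V k3" "l4 \<in> conjs M V k4"
        "\<forall>x\<in>A. l4 (l3 (l2 (l1 x))) = f x"
      by (rule chain_extend[OF mk X VX I f(1) f0 A])
    obtain a1 a2 a3 a4 where a: "a1 \<in> fixing M V" "a2 \<in> fixing M V" "a3 \<in> fixing M V" "a4 \<in> fixing M V"
      "l1 = a1 \<circ> conj_by g (h (False, False)) \<circ> inv a1" "l2 = a2 \<circ> conj_by g (h (False, True)) \<circ> inv a2"
      "l3 = a3 \<circ> conj_by g (h (True, False)) \<circ> inv a3" "l4 = a4 \<circ> conj_by g (h (True, True)) \<circ> inv a4"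
      using conjs_trans[OF k(1) l(1)] conjs_trans[OF k(2) l(2)] conjs_trans[OF k(3) l(3)]
        conjs_trans[OF k(4) l(4)] unfolding conjs_def by blast
    define a where "a = (\<lambda>(p, q). if p then (if q then a4 else a3) else (if q then a2 else a1))"
    have aV: "a i \<in> fixing M V" for i
      using a(1-4) by (simp add: a_def split: prod.split)
    note aut = fixing_Aut[OF aV] tuples_Aut[OF h]
    have "(\<lambda>i. a i \<circ> h i) \<in> tuples M"
      using aut by (auto simp: tuples_def)
    moreover have "agree Y (\<lambda>i. a i \<circ> h i) h"
      using aV by (auto simp: agree_def V_def intro: fixing_apply)
    moreover have "conj_prod g (\<lambda>i. a i \<circ> h i) = l4 \<circ> (l3 \<circ> (l2 \<circ> l1))"
      unfolding conj_prod_def conj_by_comp[OF aut] a(5-8) by (simp add: a_def)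
    ultimately show "\<exists>k\<in>tuples M. agree Y k h \<and> (\<forall>x\<in>A. conj_prod g k x = f x)"
      using l(5) by (intro bexI[of _ "\<lambda>i. a i \<circ> h i"]) auto
  qed
  with w fin show "\<exists>w\<in>Aut M. \<exists>X. finite X \<and> dense_image M (conj_prod g) h Y w X"
    by blast
qed

end

theorem theorem2p7:
  fixes M :: "('a, 'f, 'r) fo_structure"
    and indep :: "'a set \<Rightarrow> 'a set \<Rightarrow> 'a set \<Rightarrow> bool"
    and g :: "'a \<Rightarrow> 'a"
  assumes "countable (UNIV :: 'a set)"
    and "local_stationary_independence M indep"
    and "g \<in> Aut M"
    and "moves_maximally M indep g"
    and "\<exists>h\<in>Aut M. aut_topology M closure_of (conj_class M h) = topspace (aut_topology M)"
  shows "\<forall>f\<in>Aut M. \<exists>cs. length cs = 8 \<and> set cs \<subseteq> conj_class M g \<and> f = foldr (\<circ>) cs id"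
proof
  fix f assume f: "f \<in> Aut M"
  interpret local_stationary_independence M indep by fact
  \<comment> \<open>A solution of \<open>?\<Phi> h = ?\<Psi> l\<close> writes \<open>f\<close> as a
    product of two products of four conjugates.\<close>
  let ?\<Phi> = "conj_prod g" and ?\<Psi> = "\<lambda>h. f \<circ> inv (conj_prod g h)"
  have prodAut: "?\<Phi> h \<in> Aut M" if "h \<in> tuples M" for h
    using assms(3) that by (rule conj_prod_Aut)
  have \<Phi>: "somewhere_dense M ?\<Phi>" "ptwise_cont M ?\<Phi>"
    using somewhere_dense_conj_prod[OF moves_maximally_mover] ptwise_cont_conj_prod assms(3,4) by auto
  have \<Psi>: "somewhere_dense M ?\<Psi>" "ptwise_cont M ?\<Psi>"
    using somewhere_dense_comp_inv[OF \<Phi>(1) prodAut f] ptwise_cont_comp_inv[OF \<Phi>(2) prodAut] by auto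
  obtain d where d: "d \<in> Aut M" "aut_topology M closure_of conj_class M d = topspace (aut_topology M)"
    using assms(5) by blast
  have h0: "(\<lambda>_. id) \<in> tuples M"
    by (simp add: tuples_def)
  then obtain w X where w: "w \<in> Aut M" "finite X" "dense_image M ?\<Phi> (\<lambda>_. id) {} w X"
    using \<Phi>(1) unfolding somewhere_dense_def by blast
  have w': "f \<circ> inv w \<in> Aut M" "finite (w ` X)"
    using w f by blast+
  obtain k1 where k1: "k1 \<in> Aut M" "\<forall>x\<in>X. conj_by d k1 x = w x"
    using dense_conj_class_meets[OF d(2) w(1,2)] by blast
  obtain k2 where k2: "k2 \<in> Aut M" "\<forall>x\<in>w ` X. conj_by d k2 x = (f \<circ> inv w) x"
    using dense_conj_class_meets[OF d(2) w'] by blast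
  \<comment> \<open>The two open sets contain conjugates of the same \<open>d\<close>;
    \<open>k\<close> conjugates the first of these to the second and so makes the open sets
    overlap.\<close>
  define k where "k = k2 \<circ> inv k1"
  have k: "k \<in> Aut M"
    unfolding k_def using k1 k2 by blast
  have "conj_by d k2 = k \<circ> conj_by d k1 \<circ> inv k"
    using conj_by_comp[OF k k1(1), of d] k1(1) by (simp add: k_def comp_def)
  moreover have "dense_image M ?\<Phi> (\<lambda>_. id) {} (conj_by d k1) X"
    by (rule dense_image_cong[OF w(3)]) (use k1(2) in simp)
  ultimately have 1: "dense_image M ?\<Phi> (\<lambda>_. id) {} (conj_by d k2) (k ` X)"
    using dense_image_conj_prod[OF _ k assms(3)] by simp
  have 2: "dense_image M ?\<Psi> (\<lambda>_. id) {} (conj_by d k2) (w ` X)"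
    by (rule dense_image_cong[OF dense_image_comp_inv[OF w(3) prodAut w(1) f]]) (use k2(2) in blast)+
  obtain h l where hl: "h \<in> tuples M" "l \<in> tuples M" "?\<Phi> h = ?\<Psi> l"
    by (rule images_meet[OF assms(1) \<Phi> \<Psi> h0 1 finite_imageI[OF w(2)] h0 2 w'(2)
          conj_by_Aut[OF d(1) k2(1)]])
  define cs where "cs = map (conj_by g)
    [h (True, True), h (True, False), h (False, True), h (False, False),
     l (True, True), l (True, False), l (False, True), l (False, False)]"
  have "f = ?\<Phi> h \<circ> ?\<Phi> l"
    using prodAut[OF hl(2)] by (simp add: hl(3) fun_eq_iff)
  then have "f = foldr (\<circ>) cs id"
    by (simp add: cs_def conj_prod_def o_assoc)
  moreover have "length cs = 8" "set cs \<subseteq> conj_class M g"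
    using tuples_Aut[OF hl(1)] tuples_Aut[OF hl(2)] by (simp_all add: cs_def conj_by_conj_class)
  ultimately show "\<exists>cs. length cs = 8 \<and> set cs \<subseteq> conj_class M g \<and> f = foldr (\<circ>) cs id"
    by blast
qed

end
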